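(* Let $\beta\equiv\beta^{(4)}=(\beta_{ij})_{i,j\ge 0,\ i+j\le 4}$ be real numbers with $\beta_{00}>0$, and let $\mathcal{M}(2)$ be the associated $6\times 6$ moment matrix. Assume that $\mathcal{M}(2)$ is positive (semidefinite) and invertible. Then $\beta^{(4)}$ admits a representing measure with exactly $6$ atoms, i.e., there exist six distinct points $(x_1,y_1),\dots,(x_6,y_6)\in\mathbb{R}^2$ and positive real numbers $\rho_1,\dots,\rho_6$ such that $$\beta_{ij}=\sum_{k=1}^{6}\rho_k\,x_k^i\,y_k^j\qquad(i,j\ge 0,\ 0\le i+j\le 4).$$ That is, $\mathcal{M}(2)$ admits a flat extension $\mathcal{M}(3)$: there exist real numbers $\beta_{ij}$ ($i,j\ge0$, $5\le i+j\le 6$) such that the moment matrix $\mathcal{M}(3)$ associated with $(\beta_{ij})_{i+j\le 6}$ is positive semidefinite and satisfies $\operatorname{rank}\mathcal{M}(3)=\operatorname{rank}\mathcal{M}(2)=6$.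
   Context: Given a collection of real numbers $\beta^{(2n)}=(\beta_{ij})_{i,j\ge 0,\ i+j\le 2n}$, the associated moment matrix $\mathcal{M}(n)$ is the real symmetric matrix whose rows and columns are indexed by $\mathbf{i},\mathbf{j}\in\mathbb{Z}_+^2$ with $|\mathbf{i}|,|\mathbf{j}|\le n$ (where $|(i_1,i_2)|=i_1+i_2$), with entries $\mathcal{M}(n)_{\mathbf{i},\mathbf{j}}:=\beta_{\mathbf{i}+\mathbf{j}}$. For $n=2$, with the indices ordered as $(0,0),(1,0),(0,1),(2,0),(1,1),(0,2)$, $$\mathcal{M}(2)=\begin{pmatrix} \beta_{00} &\beta_{10} & \beta_{01} & \beta_{20} & \beta_{11} & \beta_{02} \\ \beta_{10} & \beta_{20} & \beta_{11} & \beta_{30} & \beta_{21} & \beta_{12} \\ \beta_{01} &\beta_{11} & \beta_{02} & \beta_{21} & \beta_{12} & \beta_{03} \\ \beta_{20} & \beta_{30} & \beta_{21} & \beta_{40} & \beta_{31} & \beta_{22} \\ \beta_{11} & \beta_{21} & \beta_{12} & \beta_{31} & \beta_{22} & \beta_{13} \\ \beta_{02} & \beta_{12} & \beta_{03} & \beta_{22} & \beta_{13} & \beta_{04} \end{pmatrix}.$$ The matrix $\mathcal{M}(3)$ is $10\times 10$ and contains $\mathcal{M}(2)$ as the compression to the indices of degree at most $2$. A representing measure for $\beta^{(4)}$ (or for $\mathcal{M}(2)$) is a positive Borel measure $\mu$ supported in $\mathbb{R}^2$ such that $\beta_{ij}=\int s^it^j\,d\mu(s,t)$ for $0\le i+j\le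 4$. *)

theory Defs
  imports "HOL-Analysis.Analysis" "Jordan_Normal_Form.DL_Rank"
begin

text \<open>
  A family of reals indexed by the pairs of naturals with \<open>i + j \<le> d\<close> is represented by a total
  function \<open>\<beta> :: nat \<Rightarrow> nat \<Rightarrow> real\<close>; its values at pairs with \<open>i + j > d\<close> are irrelevant.
\<close>

text \<open>The bi-indices of degree at most \<open>n\<close>, in degree-lexicographic order.\<close>

definition bi_indices :: "nat \<Rightarrow> (nat \<times> nat) list" where
  "bi_indices n = [(d - k, k). d \<leftarrow> [0..<Suc n], k \<leftarrow> [0..<Suc d]]"

definition moment_matrix :: "nat \<Rightarrow> (nat \<Rightarrow> nat \<Rightarrow> real) \<Rightarrow> real mat" where
  "moment_matrix n \<beta> =
     (let I = bi_indices n in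
      mat (length I) (length I)
        (\<lambda>(r, c). \<beta> (fst (I ! r) + fst (I ! c)) (snd (I ! r) + snd (I ! c))))"

definition positive_semidefinite_mat :: "real mat \<Rightarrow> bool" where
  "positive_semidefinite_mat A \<longleftrightarrow>
     square_mat A \<and> transpose_mat A = A \<and>
     (\<forall>v \<in> carrier_vec (dim_row A). 0 \<le> v \<bullet> (A *\<^sub>v v))"

abbreviation mat_rank :: "real mat \<Rightarrow> nat" where
  "mat_rank A \<equiv> vec_space.rank (dim_row A) A"

text \<open>
  A positive Borel measure on the plane representing the moments of degree at most \<open>d\<close>.
  Integrability is required explicitly, since the Bochner integral of a non-integrable
  function is \<open>0\<close>.
\<close>

definition representing_measure ::
    "nat \<Rightarrow> (nat \<Rightarrow> nat \<Rightarrow> real) \<Rightarrow> (real \<times> real) measure \<Rightarrow> bool" where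
  "representing_measure d \<beta> \<mu> \<longleftrightarrow>
     sets \<mu> = sets borel \<and>
     (\<forall>i j. i + j \<le> d \<longrightarrow>
        integrable \<mu> (\<lambda>(s, t). s ^ i * t ^ j) \<and>
        \<beta> i j = integral\<^sup>L \<mu> (\<lambda>(s, t). s ^ i * t ^ j))"

text \<open>The measure is concentrated on exactly \<open>m\<close> points, each of positive mass.\<close>

definition has_exactly_atoms :: "(real \<times> real) measure \<Rightarrow> nat \<Rightarrow> bool" where
  "has_exactly_atoms \<mu> m \<longleftrightarrow>
     (\<exists>S. finite S \<and> card S = m \<and> (\<forall>p \<in> S. 0 < emeasure \<mu> {p}) \<and>
          emeasure \<mu> (space \<mu> - S) = 0)"

lemma moment_matrix_2:
  "moment_matrix 2 \<beta> = mat_of_rows_list 6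
     [[\<beta> 0 0, \<beta> 1 0, \<beta> 0 1, \<beta> 2 0, \<beta> 1 1, \<beta> 0 2],
      [\<beta> 1 0, \<beta> 2 0, \<beta> 1 1, \<beta> 3 0, \<beta> 2 1, \<beta> 1 2],
      [\<beta> 0 1, \<beta> 1 1, \<beta> 0 2, \<beta> 2 1, \<beta> 1 2, \<beta> 0 3],
      [\<beta> 2 0, \<beta> 3 0, \<beta> 2 1, \<beta> 4 0, \<beta> 3 1, \<beta> 2 2],
      [\<beta> 1 1, \<beta> 2 1, \<beta> 1 2, \<beta> 3 1, \<beta> 2 2, \<beta> 1 3],
      [\<beta> 0 2, \<beta> 1 2, \<beta> 0 3, \<beta> 2 2, \<beta> 1 3, \<beta> 0 4]]"
proof -
  have I: "bi_indices 2 = [(0,0), (1,0), (0,1), (2,0), (1,1), (0,2)]"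
    by (simp add: bi_indices_def upt_rec numeral_2_eq_2)
  show ?thesis
    unfolding moment_matrix_def I mat_of_rows_list_def Let_def
    by (rule eq_matI) (auto simp: numeral_eq_Suc less_Suc_eq)
qed

lemma dim_row_moment_matrix_3: "dim_row (moment_matrix 3 \<beta>) = 10"
  by (simp add: moment_matrix_def bi_indices_def upt_rec numeral_3_eq_3 Let_def)

end

theory Submission
  imports Defs "Jordan_Normal_Form.DL_Rank_Submatrix"
    "HOL-Computational_Algebra.Fundamental_Theorem_Algebra"
begin

hide_const (open) Module.smult

text \<open>
  The moments of degree at most 4 are regarded as a linear functional \<open>L\<close> on ternary quartic forms in
  homogeneous coordinates, the affine point \<open>(s, t)\<close> being \<open>(1, s, t)\<close>. That \<open>M(2)\<close> is positive
  and invertible means that \<open>L (q\<^sup>2) > 0\<close> for every nonzero quadratic form \<open>q\<close>. So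
  \<open>(q, r) \<mapsto> L (q r)\<close> is an inner product on quadratic forms, and evaluation at a vector \<open>p\<close> has a
  reproducing kernel \<open>Q\<^sub>p\<close>, with \<open>L (Q\<^sub>p r) = r(p)\<close> for all \<open>r\<close>.

  Remove from \<open>L\<close> an atom at \<open>p\<close> with the largest possible mass \<open>1 / Q\<^sub>p(p)\<close>. What remains is nonnegative on
  squares and annihilates the multiples of \<open>Q\<^sub>p\<close>: it lives on the conic \<open>Q\<^sub>p = 0\<close>. If this conic
  is nondegenerate, it has real points and is parametrized by \<open>t \<mapsto> (t\<^sup>2, t, 1)\<close> in suitable
  coordinates (\<open>six_atoms_if_nondegenerate_kernel\<close>). Quartic forms become polynomials of degree at
  most 8 in \<open>t\<close>, and the remainder becomes a functional on them that is positive on squares.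
  Such a functional is a sum over 5 nodes by Gaussian quadrature. The quadrature
  is not unique: there is one free parameter, and it is used to keep the nodes away
  from the finitely many \<open>t\<close> at which the conic meets the line at infinity (\<open>quadrature_avoiding\<close>). With
  \<open>p\<close> itself this makes 6 atoms.

  It remains to find an affine \<open>p\<close> with \<open>Q\<^sub>p\<close> nondegenerate. Suppose there is no vector \<open>p\<close> at all for which
  \<open>Q\<^sub>p\<close> is nondegenerate. Positivity forces \<open>Q\<^sub>p\<close> to be a pair of distinct real lines, and the vanishing
  of the derivative of the discriminant at \<open>p\<close> shows that if \<open>p'\<close> is the common point of these
  lines, then \<open>p\<close> is the common point of the lines of \<open>Q\<^sub>p\<^sub>'\<close>. In suitable coordinates the two kernels
  are multiples of \<open>x\<^sup>2 - z\<^sup>2\<close> and \<open>y\<^sup>2 - z\<^sup>2\<close>, which determines \<open>L\<close>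
  up to a few parameters: it is a positive combination of the evaluations at \<open>p\<close>, \<open>p'\<close>
  and the four points \<open>(\<plusminus>1, \<plusminus>1, 1)\<close>. For such \<open>L\<close> all kernels are explicit, and one of them turns out to be
  nondegenerate after all (\<open>nondegenerate_kernel_if_quadrangle\<close>). A small perturbation
  moves \<open>p\<close> away from the line at infinity.

  The atoms give everything else: the measure is the sum of the point masses, and the flat extension
  \<open>M(3)\<close> is the moment matrix of that measure, a sum of six matrices of rank one that contains
  \<open>M(2)\<close> as a submatrix.
\<close>

section \<open>Gaussian quadrature with forbidden nodes\<close>

lemma map_poly_of_real_mult_add:
  fixes p q r :: "real poly"
  shows "map_poly complex_of_real (p * q + r) =
    map_poly complex_of_real p * map_poly complex_of_real q + map_poly complex_of_real r"
  by (rule poly_eqI) (simp add: coeff_map_poly coeff_mult)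

text \<open>
  A non-real root \<open>a + \<i>b\<close> of a real polynomial comes with its conjugate, and together they give the
  factor \<open>(X - a)\<^sup>2 + b\<^sup>2\<close>.
\<close>

lemma real_poly_root_or_quadratic_factor:
  fixes V :: "real poly"
  assumes "degree V > 0"
  shows "(\<exists>a. poly V a = 0) \<or> (\<exists>a b. b \<noteq> 0 \<and> [:a\<^sup>2 + b\<^sup>2, -2 * a, 1:] dvd V)"
proof -
  let ?C = "map_poly complex_of_real"
  have "degree (?C V) > 0" using assms by (simp add: degree_map_poly)
  then have "\<not> constant (poly (?C V))" by (simp add: constant_degree)
  then obtain z where z: "poly (?C V) z = 0"
    using fundamental_theorem_of_algebra by blast
  let ?a = "Re z" and ?b = "Im z"
  let ?q = "[:?a\<^sup>2 + ?b\<^sup>2, -2 * ?a, 1:]"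
  show ?thesis
  proof (cases "?b = 0")
    case True
    have "poly (?C p) (of_real x) = of_real (poly p x)" for p :: "real poly" and x
      by (induction p) (auto simp: map_poly_pCons)
    moreover have "z = of_real ?a" using True by (simp add: complex_eq_iff)
    ultimately have "complex_of_real (poly V ?a) = 0" using z by metis
    then show ?thesis by auto
  next
    case False
    have "V mod ?q = 0 \<or> degree (V mod ?q) < degree ?q"
      by (rule degree_mod_less) simp
    then have "degree (V mod ?q) \<le> 1" by auto
    then have "V mod ?q = [:coeff (V mod ?q) 0, coeff (V mod ?q) 1:]"
      by (intro poly_eqI) (auto simp: coeff_pCons coeff_eq_0 split: nat.splits)
    then obtain c d where cd: "V mod ?q = [:c, d:]" by blast
    have q0: "poly (?C ?q) z = 0"
      by (simp add: map_poly_pCons complex_eq_iff power2_eq_square algebra_simps)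
    have "poly (?C (?q * (V div ?q) + [:c, d:])) z = 0"
      using z cd by (metis mult_div_mod_eq)
    then have "poly (?C [:c, d:]) z = 0"
      unfolding map_poly_of_real_mult_add poly_add poly_mult q0 by simp
    then have "c = 0 \<and> d = 0" using False by (auto simp: complex_eq_iff map_poly_pCons)
    then have "?q dvd V" using cd by (simp add: dvd_eq_mod_eq_0)
    then show ?thesis using False by blast
  qed
qed

text \<open>
  This is \<open>degree p < m\<close>, except that it also covers the zero polynomial when \<open>m = 0\<close>.
\<close>

definition low :: "nat \<Rightarrow> real poly \<Rightarrow> bool" where
  "low m p \<longleftrightarrow> (\<forall>i\<ge>m. coeff p i = 0)"

lemma low_Suc_iff: "low (Suc m) p \<longleftrightarrow> degree p \<le> m"
  by (auto simp: low_def coeff_eq_0 Suc_le_eq) (meson degree_le)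

lemma low_add: "low m p \<Longrightarrow> low m q \<Longrightarrow> low m (p + q)"
  and low_smult: "low m p \<Longrightarrow> low m (smult c p)"
  and low_mono: "low m p \<Longrightarrow> m \<le> k \<Longrightarrow> low k p"
  by (auto simp: low_def)

locale positive_poly_functional =
  fixes \<Lambda> :: "real poly \<Rightarrow> real" and n :: nat
  assumes add: "\<Lambda> (p + q) = \<Lambda> p + \<Lambda> q"
    and smult: "\<Lambda> (smult c p) = c * \<Lambda> p"
    and pos: "p \<noteq> 0 \<Longrightarrow> degree p \<le> n \<Longrightarrow> \<Lambda> (p * p) > 0"
begin

lemma zero [simp]: "\<Lambda> 0 = 0"
  using smult[of 0 0] by simp

lemma diff: "\<Lambda> (p - q) = \<Lambda> p - \<Lambda> q"
  using add[of p "smult (-1) q"] smult[of "-1" q] by simp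

lemma sum: "\<Lambda> (\<Sum>i\<in>A. f i) = (\<Sum>i\<in>A. \<Lambda> (f i))"
  by (induction A rule: infinite_finite_induct) (auto simp: add)

definition orth :: "nat \<Rightarrow> real poly \<Rightarrow> bool" where
  "orth m p \<longleftrightarrow> (\<forall>r. low m r \<longrightarrow> \<Lambda> (p * r) = 0)"

text \<open>
  Gram-Schmidt. The step from \<open>m\<close> to \<open>m + 1\<close> divides by the square norm of the monic orthogonal polynomial of
  degree \<open>m\<close>, so positivity in degree at most \<open>n\<close> suffices for \<open>m \<le> n + 1\<close>.
\<close>

lemma projection:
  assumes "m \<le> Suc n"
  shows "\<exists>h. low m h \<and> orth m (f - h)"
  using assms
proof (induction m arbitrary: f)
  case 0
  have "low 0 r \<longleftrightarrow> r = 0" for r by (auto simp: low_def poly_eq_iff)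
  then show ?case unfolding orth_def by (intro exI[of _ 0]) auto
next
  case (Suc m)
  obtain h where h: "low m h" "orth m (f - h)" using Suc by fastforce
  obtain g where g: "low m g" "orth m (monom 1 m - g)" using Suc by fastforce
  let ?p = "monom 1 m - g"
  have cm: "coeff ?p m = 1" using g(1) by (simp add: low_def)
  have lp: "low (Suc m) ?p" using g(1) by (auto simp: low_def)
  have "?p \<noteq> 0" using cm by auto
  then have pp: "\<Lambda> (?p * ?p) > 0"
    using lp Suc.prems by (intro pos) (auto simp: low_Suc_iff)
  define c where "c = \<Lambda> ((f - h) * ?p) / \<Lambda> (?p * ?p)"
  let ?h = "h + smult c ?p"
  have "low (Suc m) ?h" using h(1) lp by (intro low_add low_smult) (auto intro: low_mono)
  moreover have "orth (Suc m) (f - ?h)"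
    unfolding orth_def
  proof (intro allI impI)
    fix r assume r: "low (Suc m) r"
    define r' where "r' = r - smult (coeff r m) ?p"
    have lr: "low m r'"
      unfolding low_def r'_def
    proof (intro allI impI)
      fix i assume "m \<le> i"
      then show "coeff (r - smult (coeff r m) ?p) i = 0"
        using cm lp r by (cases "i = m") (auto simp: low_def)
    qed
    have "(f - ?h) * r = smult (coeff r m) ((f - h) * ?p - smult c (?p * ?p))
        + ((f - h) * r' - smult c (?p * r'))"
    proof -
      have rr: "r = r' + smult (coeff r m) ?p" by (simp add: r'_def)
      show ?thesis by (subst (1) rr) (simp add: algebra_simps smult_diff_right smult_add_right del: r'_def)
    qed
    then have "\<Lambda> ((f - ?h) * r) = coeff r m * (\<Lambda> ((f - h) * ?p) - c * \<Lambda> (?p * ?p))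
        + (\<Lambda> ((f - h) * r') - c * \<Lambda> (?p * r'))"
      by (simp only: add diff smult)
    also have "\<dots> = 0"
      using h(2) g(2) lr pp by (simp add: orth_def c_def)
    finally show "\<Lambda> ((f - ?h) * r) = 0" .
  qed
  ultimately show ?case by blast
qed

text \<open>
  If \<open>p = (X - a) u\<close> and \<open>q = (X - a) w\<close>, then \<open>q u = p w\<close>. The left side is annihilated because \<open>u\<close> has
  degree less than \<open>n\<close>. On the right \<open>w\<close> is monic of degree \<open>n\<close>, as is \<open>p\<close>, so that orthogonality
  leaves \<open>\<Lambda> (p\<^sup>2) > 0\<close>.
\<close>

lemma no_common_root:
  assumes p: "coeff p n = 1" "low (Suc n) p" "orth n p"
    and q: "coeff q (Suc n) = 1" "low (Suc (Suc n)) q" "orth n q"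
    and a: "poly p a = 0"
  shows "poly q a \<noteq> 0"
proof
  assume "poly q a = 0"
  then obtain u w where u: "p = [:-a, 1:] * u" and w: "q = [:-a, 1:] * w"
    using a by (metis dvdE poly_eq_0_iff_dvd)
  have dp: "degree p = n" using p by (intro antisym le_degree) (auto simp: low_Suc_iff)
  have dq: "degree q = Suc n" using q by (intro antisym le_degree) (auto simp: low_Suc_iff)
  have p0: "p \<noteq> 0" and q0: "q \<noteq> 0" using p q by auto
  have du: "n = Suc (degree u)" using dp p0 unfolding u by (subst (asm) degree_mult_eq) auto
  have dw: "degree w = n" using dq q0 unfolding w by (subst (asm) degree_mult_eq) auto
  have cw: "coeff w n = 1"
    using q(1) dw unfolding w by (simp add: coeff_eq_0)
  have lw: "low n (w - p)"
    using cw p dw by (auto simp: low_def le_less coeff_eq_0 dp)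
  have "low n u" using du low_Suc_iff by simp
  then have "\<Lambda> (q * u) = 0" using q(3) by (simp add: orth_def)
  also have "q * u = p * p + p * (w - p)" unfolding u w by (simp add: algebra_simps)
  finally have "\<Lambda> (p * p) = 0" using lw p(3) by (simp add: add orth_def)
  then show False using pos[of p] p0 dp by simp
qed

text \<open>
  A polynomial of degree \<open>n + 1\<close> orthogonal only to degree less than \<open>n\<close> may be changed by any multiple of the
  orthogonal polynomial of degree \<open>n\<close>. As the two have no common root, each
  forbidden point excludes at most one multiple.
\<close>

lemma quasi_orthogonal_avoiding:
  assumes "finite F"
  shows "\<exists>P. degree P = Suc n \<and> orth n P \<and> (\<forall>a\<in>F. poly P a \<noteq> 0)"
proof -
  obtain g where g: "low n g" "orth n (monom 1 n - g)" using projection[of n] by auto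
  obtain h where h: "low n h" "orth n (monom 1 (Suc n) - h)" using projection[of n] by auto
  define p where "p = monom 1 n - g"
  define q where "q = monom 1 (Suc n) - h"
  have p: "coeff p n = 1" "low (Suc n) p" "orth n p"
    using g by (auto simp: p_def low_def)
  have q: "coeff q (Suc n) = 1" "low (Suc (Suc n)) q" "orth n q"
    using h by (auto simp: q_def low_def)
  obtain \<tau> where \<tau>: "\<tau> \<notin> (\<lambda>a. - poly q a / poly p a) ` F"
    using assms ex_new_if_finite[OF infinite_UNIV_char_0 finite_imageI] by blast
  let ?P = "q + smult \<tau> p"
  have "coeff p (Suc n) = 0" using p by (auto simp: low_def)
  then have "degree ?P = Suc n"
    using p q by (intro antisym le_degree)
      (auto simp: low_Suc_iff[symmetric] intro!: low_add low_smult intro: low_mono)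
  moreover have "orth n ?P"
    using p(3) q(3) by (auto simp: orth_def distrib_right add smult)
  moreover have "poly ?P a \<noteq> 0" if "a \<in> F" for a
  proof (cases "poly p a = 0")
    case True
    then show ?thesis using no_common_root[OF p q] by simp
  next
    case False
    then have "\<tau> = - poly q a / poly p a" if "poly ?P a = 0"
    proof -
      have "\<tau> * poly p a = - poly q a" using that by simp
      then show ?thesis by (metis False nonzero_mult_div_cancel_right)
    qed
    then show ?thesis using \<tau> that by blast
  qed
  ultimately show ?thesis by blast
qed

text \<open>
  If \<open>P = ((X - a)\<^sup>2 + b\<^sup>2) u\<close>, then \<open>u\<close> has degree less than \<open>n\<close>, but \<open>P u\<close> is a sum of squares.
  The case \<open>b = 0\<close> excludes double roots, and \<open>b \<noteq> 0\<close> excludes non-real ones.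
\<close>

lemma orth_not_dvd:
  assumes P: "degree P = Suc n" "orth n P" and PD: "P = D * u"
    and D: "degree D = 2" and sq: "D = [:-a, 1:] * [:-a, 1:] + [:b\<^sup>2:]"
  shows False
proof -
  have u0: "u \<noteq> 0" "D \<noteq> 0" using P PD by auto
  then have du: "n = Suc (degree u)" using P(1) D unfolding PD by (subst (asm) degree_mult_eq) auto
  let ?v = "[:-a, 1:] * u" and ?w = "smult b u"
  have "low n u" using du low_Suc_iff by simp
  then have "\<Lambda> (P * u) = 0" using P(2) by (simp add: orth_def)
  moreover have "P * u = ?v * ?v + ?w * ?w"
    unfolding PD sq by (intro poly_eq_poly_eq_iff[THEN iffD1] ext) (simp add: algebra_simps power2_eq_square)
  moreover have "\<Lambda> (?v * ?v) > 0"
    using u0 du by (intro pos) (auto simp: degree_mult_eq simp del: mult_pCons_left)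
  moreover have "\<Lambda> (?w * ?w) \<ge> 0"
  proof (cases "b = 0")
    case False
    then show ?thesis using u0 du by (intro less_imp_le pos) auto
  qed simp
  ultimately show False by (simp add: add)
qed

lemma real_simple_roots:
  assumes P: "degree P = Suc n" "orth n P"
  shows "card {a. poly P a = 0} = Suc n"
proof -
  let ?S = "{a. poly P a = 0}"
  have P0: "P \<noteq> 0" using P by auto
  have fin: "finite ?S" by (rule poly_roots_finite[OF P0])
  have dvd: "finite T \<Longrightarrow> T \<subseteq> ?S \<Longrightarrow> (\<Prod>a\<in>T. [:-a, 1:]) dvd P" for T
  proof (induction T rule: finite_induct)
    case (insert a T)
    then obtain V where V: "P = (\<Prod>a\<in>T. [:-a, 1:]) * V" by (auto elim: dvdE)
    have "poly (\<Prod>a\<in>T. [:-a, 1:]) a \<noteq> 0" using insert by (auto simp: poly_prod)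
    then have "poly V a = 0" using insert.prems V by auto
    then have "[:-a, 1:] dvd V" by (simp add: poly_eq_0_iff_dvd)
    then show ?case using insert V by (simp add: mult.commute mult_dvd_mono del: mult_pCons_left mult_pCons_right)
  qed simp
  obtain V where V: "P = (\<Prod>a\<in>?S. [:-a, 1:]) * V" using dvd[OF fin] by (auto elim: dvdE)
  have V0: "V \<noteq> 0" using V P0 by auto
  have "degree (\<Prod>a\<in>?S. [:-a, 1:]) = card ?S"
    by (subst degree_prod_eq_sum_degree) auto
  then have deg: "Suc n = card ?S + degree V"
    using P(1) V V0 fin by (metis degree_mult_eq mult_zero_left P0)
  have "degree V = 0"
  proof (rule ccontr)
    assume "degree V \<noteq> 0"
    then consider a where "poly V a = 0" | a b where "[:a\<^sup>2 + b\<^sup>2, -2 * a, 1:] dvd V"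
      using real_poly_root_or_quadratic_factor by blast
    then show False
    proof cases
      case 1
      then have aS: "a \<in> ?S" using V by (metis (mono_tags) mem_Collect_eq mult_zero_right poly_mult)
      have "[:-a, 1:] dvd V" using 1 by (simp add: poly_eq_0_iff_dvd)
      moreover have "[:-a, 1:] dvd (\<Prod>a\<in>?S. [:-a, 1:])" by (rule dvd_prodI[OF fin aS])
      ultimately have "[:-a, 1:] * [:-a, 1:] dvd P" by (subst V) (rule mult_dvd_mono)
      then obtain u where "P = [:-a, 1:] * [:-a, 1:] * u" by (auto elim: dvdE)
      then show False using orth_not_dvd[OF P, of _ u a 0] by auto
    next
      case 2
      then have "[:a\<^sup>2 + b\<^sup>2, -2 * a, 1:] dvd P" by (subst V) (rule dvd_mult)
      then obtain u where "P = [:a\<^sup>2 + b\<^sup>2, -2 * a, 1:] * u" by (auto elim: dvdE)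
      then show False using orth_not_dvd[OF P, of _ u a b] by (auto simp: power2_eq_square)
    qed
  qed
  then show ?thesis using deg by simp
qed

text \<open>
  The nodes are the roots of a quasi-orthogonal polynomial \<open>P\<close>. Division by \<open>P\<close> reduces a polynomial of degree
  at most \<open>2 n\<close> to its Lagrange interpolation, and the weight of a node is the value of \<open>\<Lambda>\<close> on the square of
  its Lagrange polynomial.
\<close>

lemma quadrature_avoiding:
  assumes "finite F"
  shows "\<exists>T w. finite T \<and> card T = Suc n \<and> T \<inter> F = {} \<and> (\<forall>t\<in>T. w t > 0) \<and>
    (\<forall>p. degree p \<le> 2 * n \<longrightarrow> \<Lambda> p = (\<Sum>t\<in>T. w t * poly p t))"
proof -
  obtain P where P: "degree P = Suc n" "orth n P" "\<forall>a\<in>F. poly P a \<noteq> 0"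
    using quasi_orthogonal_avoiding[OF assms] by blast
  define T where "T = {a. poly P a = 0}"
  have P0: "P \<noteq> 0" using P by auto
  have T: "finite T" "card T = Suc n" "T \<inter> F = {}"
    using P real_simple_roots poly_roots_finite[OF P0] by (auto simp: T_def)
  define l where "l t = smult (1 / (\<Prod>s\<in>T - {t}. t - s)) (\<Prod>s\<in>T - {t}. [:-s, 1:])" for t
  have nz: "(\<Prod>s\<in>T - {t}. t - s) \<noteq> 0" for t using T(1) by auto
  have l1: "poly (l t) s = (if s = t then 1 else 0)" if "t \<in> T" "s \<in> T" for s t
    using that T(1) nz by (auto simp: l_def poly_prod)
  have dl: "degree (l t) \<le> n" if "t \<in> T" for t
  proof -
    have "degree (\<Prod>s\<in>T - {t}. [:-s, 1:]) = n"
      using T that by (subst degree_prod_eq_sum_degree) auto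
    then show ?thesis by (simp add: l_def)
  qed
  define w where "w t = \<Lambda> (l t)" for t
  have exact: "\<Lambda> p = (\<Sum>t\<in>T. w t * poly p t)" if p: "degree p \<le> 2 * n" for p
  proof -
    have "p mod P = 0 \<or> degree (p mod P) < degree P" by (rule degree_mod_less[OF P0])
    then have dm: "degree (p mod P) \<le> n" using P by auto
    have "low n (p div P)"
    proof (cases "p div P = 0")
      case False
      then have "degree p = degree P + degree (p div P)"
        using P0 by (metis degree_div_less degree_mult_eq degree_add_eq_left dm P(1) degree_add_eq_left mult_div_mod_eq le_imp_less_Suc trans_less_add1)
      then have "n = Suc (n - 1)" "degree (p div P) \<le> n - 1" using p P by auto
      then show ?thesis by (metis low_Suc_iff)
    qed (simp add: low_def)
    then have "\<Lambda> (P * (p div P)) = 0" using P(2) by (simp add: orth_def)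
    then have "\<Lambda> p = \<Lambda> (p mod P)" using add[of "P * (p div P)" "p mod P"] by simp
    also have "p mod P = (\<Sum>t\<in>T. smult (poly p t) (l t))"
    proof (rule poly_eqI_degree[of T])
      fix x assume x: "x \<in> T"
      have "poly (p mod P) x = poly p x"
        using x by (metis (mono_tags) T_def add_0 mem_Collect_eq mult_div_mod_eq mult_zero_left poly_add poly_mult)
      also have "\<dots> = (\<Sum>t\<in>T. if t = x then poly p t else 0)" using T x by simp
      also have "\<dots> = poly (\<Sum>t\<in>T. smult (poly p t) (l t)) x"
        unfolding poly_sum poly_smult by (rule sum.cong) (auto simp: l1 x)
      finally show "poly (p mod P) x = poly (\<Sum>t\<in>T. smult (poly p t) (l t)) x" .
    next
      show "degree (p mod P) < card T" using dm T by simp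
      have "degree (\<Sum>t\<in>T. smult (poly p t) (l t)) \<le> n"
        by (rule degree_sum_le[OF T(1)]) (metis degree_smult_le dl order_trans)
      then show "degree (\<Sum>t\<in>T. smult (poly p t) (l t)) < card T" using T by simp
    qed
    also have "\<Lambda> \<dots> = (\<Sum>t\<in>T. w t * poly p t)"
      by (simp add: sum smult w_def mult.commute)
    finally show ?thesis .
  qed
  have "w t > 0" if t: "t \<in> T" for t
  proof -
    have "degree (l t * l t) \<le> 2 * n" using degree_mult_le[of "l t" "l t"] dl[OF t] by simp
    then have "\<Lambda> (l t * l t) = (\<Sum>s\<in>T. w s * poly (l t * l t) s)" by (rule exact)
    also have "\<dots> = (\<Sum>s\<in>T. if s = t then w s else 0)"
      by (rule sum.cong) (auto simp: l1 t)
    also have "\<dots> = w t" using T t by simp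
    finally have "\<Lambda> (l t * l t) = w t" .
    moreover have "l t \<noteq> 0" using l1[OF t t] by auto
    ultimately show ?thesis using pos[of "l t"] dl[OF t] by simp
  qed
  then show ?thesis using T exact by blast
qed

end

section \<open>Ternary quadratic forms and linear substitutions\<close>

type_synonym ternary = "real \<Rightarrow> real \<Rightarrow> real \<Rightarrow> real"

definition qform :: "real \<Rightarrow> real \<Rightarrow> real \<Rightarrow> real \<Rightarrow> real \<Rightarrow> real \<Rightarrow> ternary" where
  "qform a b c d e f =
     (\<lambda>x y z. a * x\<^sup>2 + b * y\<^sup>2 + c * z\<^sup>2 + d * (x * y) + e * (x * z) + f * (y * z))"

text \<open>
  Four times the determinant of the symmetric matrix of the form.
\<close>

definition disc :: "real \<Rightarrow> real \<Rightarrow> real \<Rightarrow> real \<Rightarrow> real \<Rightarrow> real \<Rightarrow> real" where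
  "disc a b c d e f = 4 * a * b * c + d * e * f - a * f\<^sup>2 - b * e\<^sup>2 - c * d\<^sup>2"

definition quadratic :: "ternary \<Rightarrow> bool" where
  "quadratic q \<longleftrightarrow> (\<exists>a b c d e f. q = qform a b c d e f)"

definition nondegenerate :: "ternary \<Rightarrow> bool" where
  "nondegenerate q \<longleftrightarrow> (\<exists>a b c d e f. q = qform a b c d e f \<and> disc a b c d e f \<noteq> 0)"

lemma quadratic_qform [simp]: "quadratic (qform a b c d e f)"
  unfolding quadratic_def by blast

lemma qform_eq_iff:
  "qform a b c d e f = qform a' b' c' d' e' f' \<longleftrightarrow>
   a = a' \<and> b = b' \<and> c = c' \<and> d = d' \<and> e = e' \<and> f = f'"
proof
  assume *: "qform a b c d e f = qform a' b' c' d' e' f'"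
  have **: "qform a b c d e f x y z = qform a' b' c' d' e' f' x y z" for x y z using * by simp
  show "a = a' \<and> b = b' \<and> c = c' \<and> d = d' \<and> e = e' \<and> f = f'"
    using **[of 1 0 0] **[of 0 1 0] **[of 0 0 1] **[of 1 1 0] **[of 1 0 1] **[of 0 1 1]
    by (auto simp: qform_def)
qed auto

lemma qform_eq_0_iff:
  "qform a b c d e f = (\<lambda>x y z. 0) \<longleftrightarrow> a = 0 \<and> b = 0 \<and> c = 0 \<and> d = 0 \<and> e = 0 \<and> f = 0"
proof -
  have "(\<lambda>x y z. 0) = qform 0 0 0 0 0 0" by (simp add: qform_def)
  then show ?thesis by (simp add: qform_eq_iff)
qed

text \<open>
  Composition with the linear map whose matrix has the rows \<open>(a, b, c)\<close>, \<open>(d, e, f)\<close>, \<open>(g, h, i)\<close>.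
\<close>

definition lsub :: "real \<Rightarrow> real \<Rightarrow> real \<Rightarrow> real \<Rightarrow> real \<Rightarrow> real \<Rightarrow> real \<Rightarrow> real \<Rightarrow> real \<Rightarrow> ternary \<Rightarrow> ternary" where
  "lsub a b c d e f g h i F =
     (\<lambda>x y z. F (a * x + b * y + c * z) (d * x + e * y + f * z) (g * x + h * y + i * z))"

definition det3 :: "real \<Rightarrow> real \<Rightarrow> real \<Rightarrow> real \<Rightarrow> real \<Rightarrow> real \<Rightarrow> real \<Rightarrow> real \<Rightarrow> real \<Rightarrow> real" where
  "det3 a b c d e f g h i = a * (e * i - f * h) - b * (d * i - f * g) + c * (d * h - e * g)"

lemma lsub_qform:
  "lsub a b c d e f g h i (qform A B C D E F) = qform
    (A * a\<^sup>2 + B * d\<^sup>2 + C * g\<^sup>2 + D * (a * d) + E * (a * g) + F * (d * g))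
    (A * b\<^sup>2 + B * e\<^sup>2 + C * h\<^sup>2 + D * (b * e) + E * (b * h) + F * (e * h))
    (A * c\<^sup>2 + B * f\<^sup>2 + C * i\<^sup>2 + D * (c * f) + E * (c * i) + F * (f * i))
    (2 * A * a * b + 2 * B * d * e + 2 * C * g * h + D * (a * e + b * d) + E * (a * h + b * g) + F * (d * h + e * g))
    (2 * A * a * c + 2 * B * d * f + 2 * C * g * i + D * (a * f + c * d) + E * (a * i + c * g) + F * (d * i + f * g))
    (2 * A * b * c + 2 * B * e * f + 2 * C * h * i + D * (b * f + c * e) + E * (b * i + c * h) + F * (e * i + f * h))"
  by (intro ext) (simp add: lsub_def qform_def algebra_simps power2_eq_square)

lemma disc_lsub: 
  "disc
    (A * a\<^sup>2 + B * d\<^sup>2 + C * g\<^sup>2 + D * (a * d) + E * (a * g) + F * (d * g))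
    (A * b\<^sup>2 + B * e\<^sup>2 + C * h\<^sup>2 + D * (b * e) + E * (b * h) + F * (e * h))
    (A * c\<^sup>2 + B * f\<^sup>2 + C * i\<^sup>2 + D * (c * f) + E * (c * i) + F * (f * i))
    (2 * A * a * b + 2 * B * d * e + 2 * C * g * h + D * (a * e + b * d) + E * (a * h + b * g) + F * (d * h + e * g))
    (2 * A * a * c + 2 * B * d * f + 2 * C * g * i + D * (a * f + c * d) + E * (a * i + c * g) + F * (d * i + f * g))
    (2 * A * b * c + 2 * B * e * f + 2 * C * h * i + D * (b * f + c * e) + E * (b * i + c * h) + F * (e * i + f * h))
   = (det3 a b c d e f g h i)\<^sup>2 * disc A B C D E F"
  unfolding disc_def det3_def by Groebner_Basis.algebra


lemma quadratic_lsub: "quadratic q \<Longrightarrow> quadratic (lsub a b c d e f g h i q)"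
  by (auto simp: quadratic_def lsub_qform simp del: quadratic_qform intro: quadratic_qform[unfolded quadratic_def])

lemma nondegenerate_lsub:
  "det3 a b c d e f g h i \<noteq> 0 \<Longrightarrow> nondegenerate q \<Longrightarrow> nondegenerate (lsub a b c d e f g h i q)"
  unfolding nondegenerate_def
  by (elim exE conjE, simp only: lsub_qform, intro exI conjI, rule refl) (simp add: disc_lsub)

text \<open>
  The inverse matrix by Cramer's rule.
\<close>

lemma lsub_inverse:
  assumes "det3 a b c d e f g h i \<noteq> 0"
  obtains a' b' c' d' e' f' g' h' i' where
    "det3 a' b' c' d' e' f' g' h' i' \<noteq> 0"
    "\<And>F. lsub a b c d e f g h i (lsub a' b' c' d' e' f' g' h' i' F) = F"
    "\<And>F. lsub a' b' c' d' e' f' g' h' i' (lsub a b c d e f g h i F) = F"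
proof -
  let ?D = "det3 a b c d e f g h i"
  have D: "inverse ?D * ?D = 1" using assms by simp
  define k where "k = inverse ?D"
  let ?a = "k * (e * i - f * h)" and ?b = "k * (c * h - b * i)" and ?c = "k * (b * f - c * e)"
  let ?d = "k * (f * g - d * i)" and ?e = "k * (a * i - c * g)" and ?f = "k * (c * d - a * f)"
  let ?g = "k * (d * h - e * g)" and ?h = "k * (b * g - a * h)" and ?i = "k * (a * e - b * d)"
  have k: "k * (a * (e * i - f * h) - b * (d * i - f * g) + c * (d * h - e * g)) = 1"
    using D by (simp add: k_def det3_def)
  have "det3 ?a ?b ?c ?d ?e ?f ?g ?h ?i = k ^ 3 * ?D\<^sup>2"
    unfolding det3_def by Groebner_Basis.algebra
  then have "det3 ?a ?b ?c ?d ?e ?f ?g ?h ?i \<noteq> 0" using assms by (simp add: k_def)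
  moreover have "lsub a b c d e f g h i (lsub ?a ?b ?c ?d ?e ?f ?g ?h ?i F) = F" for F
  proof (intro ext)
    fix x y z
    have "?a * (a * x + b * y + c * z) + ?b * (d * x + e * y + f * z) + ?c * (g * x + h * y + i * z) = x"
      "?d * (a * x + b * y + c * z) + ?e * (d * x + e * y + f * z) + ?f * (g * x + h * y + i * z) = y"
      "?g * (a * x + b * y + c * z) + ?h * (d * x + e * y + f * z) + ?i * (g * x + h * y + i * z) = z"
      using k by Groebner_Basis.algebra+
    then show "lsub a b c d e f g h i (lsub ?a ?b ?c ?d ?e ?f ?g ?h ?i F) x y z = F x y z"
      by (simp add: lsub_def)
  qed
  moreover have "lsub ?a ?b ?c ?d ?e ?f ?g ?h ?i (lsub a b c d e f g h i F) = F" for F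
  proof (intro ext)
    fix x y z
    have "a * (?a * x + ?b * y + ?c * z) + b * (?d * x + ?e * y + ?f * z) + c * (?g * x + ?h * y + ?i * z) = x"
      "d * (?a * x + ?b * y + ?c * z) + e * (?d * x + ?e * y + ?f * z) + f * (?g * x + ?h * y + ?i * z) = y"
      "g * (?a * x + ?b * y + ?c * z) + h * (?d * x + ?e * y + ?f * z) + i * (?g * x + ?h * y + ?i * z) = z"
      using k by Groebner_Basis.algebra+
    then show "lsub ?a ?b ?c ?d ?e ?f ?g ?h ?i (lsub a b c d e f g h i F) x y z = F x y z"
      by (simp add: lsub_def)
  qed
  ultimately show thesis by (rule that)
qed

section \<open>Functionals on quartic forms and their reproducing kernels\<close>

text \<open>
  The functionals of interest act on quartic forms. Letting them act on all functions of three variables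
  makes products and linear substitutions plain operations on functions.
\<close>

locale linear_functional =
  fixes L :: "ternary \<Rightarrow> real"
  assumes add: "L (\<lambda>x y z. f x y z + g x y z) = L f + L g"
    and scale: "L (\<lambda>x y z. c * f x y z) = c * L f"
begin

lemma zero: "L (\<lambda>x y z. 0) = 0"
  using scale[of 0 "\<lambda>x y z. 0"] by simp

lemma mult_qform:
  "L (\<lambda>x y z. q x y z * qform a b c d e f x y z) =
    a * L (\<lambda>x y z. q x y z * x\<^sup>2) + b * L (\<lambda>x y z. q x y z * y\<^sup>2) + c * L (\<lambda>x y z. q x y z * z\<^sup>2)
    + d * L (\<lambda>x y z. q x y z * (x * y)) + e * L (\<lambda>x y z. q x y z * (x * z))
    + f * L (\<lambda>x y z. q x y z * (y * z))"
proof -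
  have "(\<lambda>x y z. q x y z * qform a b c d e f x y z) = (\<lambda>x y z.
     a * (q x y z * x\<^sup>2) + b * (q x y z * y\<^sup>2) + c * (q x y z * z\<^sup>2)
    + d * (q x y z * (x * y)) + e * (q x y z * (x * z)) + f * (q x y z * (y * z)))"
    by (intro ext) (simp add: qform_def algebra_simps)
  then show ?thesis by (simp only: add scale)
qed

text \<open>
  In terms of the fifteen moments of degree 4 an identity between values of \<open>L\<close> becomes a polynomial
  identity in the coefficients of the forms involved.
\<close>

definition mom :: "nat \<Rightarrow> nat \<Rightarrow> nat \<Rightarrow> real" where
  "mom i j k = L (\<lambda>x y z. x ^ i * y ^ j * z ^ k)"

lemma mult_qform_mom:
  "L (\<lambda>x y z. qform a b c d e f x y z * qform a' b' c' d' e' f' x y z) =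
    (a * a') * mom 4 0 0 + (b * b') * mom 0 4 0 + (c * c') * mom 0 0 4
    + (a * d' + d * a') * mom 3 1 0 + (a * e' + e * a') * mom 3 0 1
    + (b * d' + d * b') * mom 1 3 0 + (b * f' + f * b') * mom 0 3 1
    + (c * e' + e * c') * mom 1 0 3 + (c * f' + f * c') * mom 0 1 3
    + (a * b' + b * a' + d * d') * mom 2 2 0 + (a * c' + c * a' + e * e') * mom 2 0 2
    + (b * c' + c * b' + f * f') * mom 0 2 2
    + (a * f' + f * a' + d * e' + e * d') * mom 2 1 1
    + (b * e' + e * b' + d * f' + f * d') * mom 1 2 1
    + (c * d' + d * c' + e * f' + f * e') * mom 1 1 2"
proof -
  have "(\<lambda>x y z. qform a b c d e f x y z * qform a' b' c' d' e' f' x y z) = (\<lambda>x y z.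
    (a * a') * (x ^ 4 * y ^ 0 * z ^ 0) + (b * b') * (x ^ 0 * y ^ 4 * z ^ 0) + (c * c') * (x ^ 0 * y ^ 0 * z ^ 4)
    + (a * d' + d * a') * (x ^ 3 * y ^ 1 * z ^ 0) + (a * e' + e * a') * (x ^ 3 * y ^ 0 * z ^ 1)
    + (b * d' + d * b') * (x ^ 1 * y ^ 3 * z ^ 0) + (b * f' + f * b') * (x ^ 0 * y ^ 3 * z ^ 1)
    + (c * e' + e * c') * (x ^ 1 * y ^ 0 * z ^ 3) + (c * f' + f * c') * (x ^ 0 * y ^ 1 * z ^ 3)
    + (a * b' + b * a' + d * d') * (x ^ 2 * y ^ 2 * z ^ 0) + (a * c' + c * a' + e * e') * (x ^ 2 * y ^ 0 * z ^ 2)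
    + (b * c' + c * b' + f * f') * (x ^ 0 * y ^ 2 * z ^ 2)
    + (a * f' + f * a' + d * e' + e * d') * (x ^ 2 * y ^ 1 * z ^ 1)
    + (b * e' + e * b' + d * f' + f * d') * (x ^ 1 * y ^ 2 * z ^ 1)
    + (c * d' + d * c' + e * f' + f * e') * (x ^ 1 * y ^ 1 * z ^ 2))"
    by (intro ext) (simp add: qform_def, Groebner_Basis.algebra)
  then show ?thesis by (simp only: add scale mom_def)
qed

end

locale quartic_functional = linear_functional +
  assumes pos: "quadratic q \<Longrightarrow> q \<noteq> (\<lambda>x y z. 0) \<Longrightarrow> L (\<lambda>x y z. q x y z * q x y z) > 0"
begin

definition kernel_at :: "real \<Rightarrow> real \<Rightarrow> real \<Rightarrow> ternary \<Rightarrow> bool" where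
  "kernel_at u v w q \<longleftrightarrow> quadratic q \<and>
     (\<forall>r. quadratic r \<longrightarrow> L (\<lambda>x y z. q x y z * r x y z) = r u v w)"

text \<open>
  For a positive functional the map from the six coefficients of a form \<open>q\<close> to the values \<open>L (q m)\<close> at the six
  quadratic monomials \<open>m\<close> is injective, hence surjective: every linear functional on
  quadratic forms is represented by a form.
\<close>

lemma riesz:
  obtains a b c d e f where
    "\<And>a' b' c' d' e' f'. L (\<lambda>x y z. qform a b c d e f x y z * qform a' b' c' d' e' f' x y z)
      = a' * A + b' * B + c' * C + d' * D + e' * E + f' * F"
proof -
  let ?q = "\<lambda>(a, b, c, d, e, f). qform a b c d e f"
  define \<Phi> where "\<Phi> p =
    (L (\<lambda>x y z. ?q p x y z * x\<^sup>2), L (\<lambda>x y z. ?q p x y z * y\<^sup>2), L (\<lambda>x y z. ?q p x y z * z\<^sup>2),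
     L (\<lambda>x y z. ?q p x y z * (x * y)), L (\<lambda>x y z. ?q p x y z * (x * z)), L (\<lambda>x y z. ?q p x y z * (y * z)))"
    for p :: "real \<times> real \<times> real \<times> real \<times> real \<times> real"
  have q_add: "?q (p + p') x y z * m = ?q p x y z * m + ?q p' x y z * m"
    and q_scale: "?q (k *\<^sub>R p) x y z * m = k * (?q p x y z * m)" for p p' x y z k m
    by (auto simp: qform_def split_beta algebra_simps)
  have lin: "linear \<Phi>"
    by (rule linearI) (simp_all only: \<Phi>_def q_add q_scale add scale, simp_all)
  have "inj \<Phi>"
  proof (subst linear_injective_0[OF lin], intro allI impI)
    fix p assume p: "\<Phi> p = 0"
    obtain a b c d e f where [simp]: "p = (a, b, c, d, e, f)" by (metis surj_pair)
    have "L (\<lambda>x y z. qform a b c d e f x y z * qform a b c d e f x y z) = 0"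
      using p by (subst mult_qform) (simp add: \<Phi>_def zero_prod_def)
    then have "qform a b c d e f = (\<lambda>x y z. 0)"
      using pos[of "qform a b c d e f"] by force
    then show "p = 0" by (simp add: qform_eq_0_iff zero_prod_def)
  qed
  then have "surj \<Phi>" using linear_injective_imp_surjective[OF lin] by simp
  then obtain p where "\<Phi> p = (A, B, C, D, E, F)" by (metis surjD)
  moreover obtain a b c d e f where "p = (a, b, c, d, e, f)" by (metis surj_pair)
  ultimately have "L (\<lambda>x y z. qform a b c d e f x y z * qform a' b' c' d' e' f' x y z)
      = a' * A + b' * B + c' * C + d' * D + e' * E + f' * F" for a' b' c' d' e' f'
    by (subst mult_qform) (simp add: \<Phi>_def)
  then show thesis by (rule that)
qed

lemma kernel_atI:
  assumes "\<And>a' b' c' d' e' f'. L (\<lambda>x y z. qform a b c d e f x y z * qform a' b' c' d' e' f' x y z)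
      = a' * u\<^sup>2 + b' * v\<^sup>2 + c' * w\<^sup>2 + d' * (u * v) + e' * (u * w) + f' * (v * w)"
  shows "kernel_at u v w (qform a b c d e f)"
  unfolding kernel_at_def
proof (intro conjI allI impI)
  fix r assume "quadratic r"
  then show "L (\<lambda>x y z. qform a b c d e f x y z * r x y z) = r u v w"
    unfolding quadratic_def by (elim exE) (simp only: assms, simp add: qform_def)
qed simp

lemma kernel_exists: "\<exists>q. kernel_at u v w q"
proof -
  obtain a b c d e f where
    "\<And>a' b' c' d' e' f'. L (\<lambda>x y z. qform a b c d e f x y z * qform a' b' c' d' e' f' x y z)
      = a' * u\<^sup>2 + b' * v\<^sup>2 + c' * w\<^sup>2 + d' * (u * v) + e' * (u * w) + f' * (v * w)"
    using riesz[of "u\<^sup>2" "v\<^sup>2" "w\<^sup>2" "u * v" "u * w" "v * w"] by blast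
  from kernel_atI[OF this] show ?thesis by blast
qed

lemma kernel_atD: "kernel_at u v w q \<Longrightarrow> quadratic r \<Longrightarrow> L (\<lambda>x y z. q x y z * r x y z) = r u v w"
  by (simp add: kernel_at_def)

text \<open>
  The value is the square norm \<open>L (q\<^sup>2)\<close>.
\<close>

lemma kernel_at_diag_pos:
  assumes "kernel_at u v w q" "(u, v, w) \<noteq> (0, 0, 0)"
  shows "q u v w > 0"
proof -
  have "q \<noteq> (\<lambda>x y z. 0)"
  proof
    assume "q = (\<lambda>x y z. 0)"
    then have 0: "qform a b c d e f u v w = 0" for a b c d e f
      using kernel_atD[OF assms(1) quadratic_qform[of a b c d e f]] by (simp add: zero)
    have "u\<^sup>2 = 0" "v\<^sup>2 = 0" "w\<^sup>2 = 0"
      using 0[of 1 0 0 0 0 0] 0[of 0 1 0 0 0 0] 0[of 0 0 1 0 0 0] by (auto simp: qform_def)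
    then show False using assms(2) by simp
  qed
  moreover have q: "quadratic q" using assms(1) by (simp add: kernel_at_def)
  ultimately have "L (\<lambda>x y z. q x y z * q x y z) > 0" by (intro pos)
  then show ?thesis by (simp only: kernel_atD[OF assms(1) q])
qed

lemma quartic_functional_lsub:
  assumes "det3 a b c d e f g h i \<noteq> 0"
  shows "quartic_functional (\<lambda>F. L (lsub a b c d e f g h i F))"
proof
  show "L (lsub a b c d e f g h i (\<lambda>x y z. k x y z + l x y z)) =
    L (lsub a b c d e f g h i k) + L (lsub a b c d e f g h i l)" for k l
    by (simp add: lsub_def add)
  show "L (lsub a b c d e f g h i (\<lambda>x y z. m * k x y z)) = m * L (lsub a b c d e f g h i k)" for m k
    by (simp add: lsub_def scale)
  fix q assume q: "quadratic q" "q \<noteq> (\<lambda>x y z. 0)"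
  have "lsub a b c d e f g h i q \<noteq> (\<lambda>x y z. 0)"
  proof
    assume *: "lsub a b c d e f g h i q = (\<lambda>x y z. 0)"
    obtain a' b' c' d' e' f' g' h' i' where
      "lsub a' b' c' d' e' f' g' h' i' (lsub a b c d e f g h i q) = q"
      using lsub_inverse[OF assms] by metis
    then have "q = (\<lambda>x y z. 0)" unfolding * by (simp add: lsub_def)
    then show False using q(2) by simp
  qed
  then have "L (\<lambda>x y z. lsub a b c d e f g h i q x y z * lsub a b c d e f g h i q x y z) > 0"
    using q(1) by (intro pos quadratic_lsub)
  then show "L (lsub a b c d e f g h i (\<lambda>x y z. q x y z * q x y z)) > 0"
    by (simp add: lsub_def)
qed

lemma kernel_at_lsub:
  assumes D: "det3 a b c d e f g h i \<noteq> 0"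
  shows "kernel_at u v w (lsub a b c d e f g h i q) \<longleftrightarrow>
    quartic_functional.kernel_at (\<lambda>F. L (lsub a b c d e f g h i F))
      (a * u + b * v + c * w) (d * u + e * v + f * w) (g * u + h * v + i * w) q"
proof -
  interpret M: quartic_functional "\<lambda>F. L (lsub a b c d e f g h i F)"
    by (rule quartic_functional_lsub[OF D])
  let ?S = "lsub a b c d e f g h i"
  obtain a' b' c' d' e' f' g' h' i' where
    inv: "\<And>F. ?S (lsub a' b' c' d' e' f' g' h' i' F) = F"
      "\<And>F. lsub a' b' c' d' e' f' g' h' i' (?S F) = F"
    using lsub_inverse[OF D] by metis
  have *: "L (?S (\<lambda>x y z. q x y z * r x y z)) = L (\<lambda>x y z. ?S q x y z * ?S r x y z)" for r
    by (simp add: lsub_def)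
  have **: "?S r u v w = r (a * u + b * v + c * w) (d * u + e * v + f * w) (g * u + h * v + i * w)" for r
    by (simp add: lsub_def)
  show ?thesis
  proof
    assume K: "kernel_at u v w (?S q)"
    show "M.kernel_at (a * u + b * v + c * w) (d * u + e * v + f * w) (g * u + h * v + i * w) q"
      unfolding M.kernel_at_def
    proof (intro conjI allI impI)
      have "quadratic (?S q)" using K by (simp add: kernel_at_def)
      from quadratic_lsub[OF this, of a' b' c' d' e' f' g' h' i'] show "quadratic q"
        by (simp only: inv)
      fix r assume r: "quadratic r"
      show "L (?S (\<lambda>x y z. q x y z * r x y z)) =
        r (a * u + b * v + c * w) (d * u + e * v + f * w) (g * u + h * v + i * w)"
        unfolding * **[symmetric] by (rule kernel_atD[OF K quadratic_lsub[OF r]])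
    qed
  next
    assume M: "M.kernel_at (a * u + b * v + c * w) (d * u + e * v + f * w) (g * u + h * v + i * w) q"
    show "kernel_at u v w (?S q)"
      unfolding kernel_at_def
    proof (intro conjI allI impI)
      show "quadratic (?S q)" using M by (simp add: M.kernel_at_def quadratic_lsub)
      fix r assume r: "quadratic r"
      have "quadratic (lsub a' b' c' d' e' f' g' h' i' r)" by (rule quadratic_lsub[OF r])
      from M.kernel_atD[OF M this] show "L (\<lambda>x y z. ?S q x y z * r x y z) = r u v w"
        unfolding * **[symmetric] inv .
    qed
  qed
qed

end

section \<open>Existence of a nondegenerate kernel\<close>

text \<open>
  Used for polynomial families: if \<open>t * h t\<close> vanishes for all \<open>t\<close>, then so does the lowest coefficient \<open>h 0\<close>.
\<close>

lemma continuous_eq_0_if_punctured: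
  fixes h :: "real \<Rightarrow> real"
  assumes "isCont h 0" "\<And>t. t \<noteq> 0 \<Longrightarrow> h t = 0"
  shows "h 0 = 0"
proof -
  have "eventually (\<lambda>t. h t = 0) (at 0)"
    using assms(2) by (auto simp: eventually_at_filter)
  then have "(h \<longlongrightarrow> 0) (at 0)" by (rule tendsto_eventually)
  then show ?thesis using assms(1) unfolding isCont_def by (rule LIM_unique[rotated])
qed

lemma binary_square:
  fixes \<alpha> \<beta> \<gamma> :: real
  assumes "\<alpha> \<ge> 0" "\<gamma> \<ge> 0" "\<beta>\<^sup>2 = 4 * \<alpha> * \<gamma>"
  obtains \<sigma> \<tau> where "\<alpha> = \<sigma>\<^sup>2" "\<gamma> = \<tau>\<^sup>2" "\<beta> = 2 * \<sigma> * \<tau>"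
proof -
  have "(2 * sqrt \<alpha> * sqrt \<gamma>)\<^sup>2 = \<beta>\<^sup>2" using assms by (simp add: power_mult_distrib)
  then have "\<beta> = 2 * sqrt \<alpha> * sqrt \<gamma> \<or> \<beta> = 2 * sqrt \<alpha> * (- sqrt \<gamma>)"
    by (auto simp: power2_eq_iff)
  then show thesis using that[of "sqrt \<alpha>" "sqrt \<gamma>"] that[of "sqrt \<alpha>" "- sqrt \<gamma>"] assms by auto
qed

context quartic_functional
begin

lemma kernel_at_scale:
  assumes "kernel_at u v w (qform a b c d e f)"
  shows "kernel_at (k * u) (k * v) (k * w)
    (qform (k\<^sup>2 * a) (k\<^sup>2 * b) (k\<^sup>2 * c) (k\<^sup>2 * d) (k\<^sup>2 * e) (k\<^sup>2 * f))"
proof (rule kernel_atI)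
  fix a' b' c' d' e' f'
  have "(\<lambda>x y z. qform (k\<^sup>2 * a) (k\<^sup>2 * b) (k\<^sup>2 * c) (k\<^sup>2 * d) (k\<^sup>2 * e) (k\<^sup>2 * f) x y z
      * qform a' b' c' d' e' f' x y z) =
    (\<lambda>x y z. k\<^sup>2 * (qform a b c d e f x y z * qform a' b' c' d' e' f' x y z))"
    by (intro ext) (simp add: qform_def algebra_simps)
  then have "L (\<lambda>x y z. qform (k\<^sup>2 * a) (k\<^sup>2 * b) (k\<^sup>2 * c) (k\<^sup>2 * d) (k\<^sup>2 * e) (k\<^sup>2 * f) x y z
      * qform a' b' c' d' e' f' x y z) = k\<^sup>2 * qform a' b' c' d' e' f' u v w"
    by (simp only: scale kernel_atD[OF assms quadratic_qform])
  also have "\<dots> = a' * (k * u)\<^sup>2 + b' * (k * v)\<^sup>2 + c' * (k * w)\<^sup>2 + d' * (k * u * (k * v))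
      + e' * (k * u * (k * w)) + f' * (k * v * (k * w))"
    by (simp add: qform_def algebra_simps power2_eq_square)
  finally show "L (\<lambda>x y z. qform (k\<^sup>2 * a) (k\<^sup>2 * b) (k\<^sup>2 * c) (k\<^sup>2 * d) (k\<^sup>2 * e) (k\<^sup>2 * f) x y z
      * qform a' b' c' d' e' f' x y z) = \<dots>" .
qed

lemma kernel_atI_mom:
  assumes
    "a * mom 4 0 0 + b * mom 2 2 0 + c * mom 2 0 2 + d * mom 3 1 0 + e * mom 3 0 1 + f * mom 2 1 1 = u\<^sup>2"
    "a * mom 2 2 0 + b * mom 0 4 0 + c * mom 0 2 2 + d * mom 1 3 0 + e * mom 1 2 1 + f * mom 0 3 1 = v\<^sup>2"
    "a * mom 2 0 2 + b * mom 0 2 2 + c * mom 0 0 4 + d * mom 1 1 2 + e * mom 1 0 3 + f * mom 0 1 3 = w\<^sup>2"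
    "a * mom 3 1 0 + b * mom 1 3 0 + c * mom 1 1 2 + d * mom 2 2 0 + e * mom 2 1 1 + f * mom 1 2 1 = u * v"
    "a * mom 3 0 1 + b * mom 1 2 1 + c * mom 1 0 3 + d * mom 2 1 1 + e * mom 2 0 2 + f * mom 1 1 2 = u * w"
    "a * mom 2 1 1 + b * mom 0 3 1 + c * mom 0 1 3 + d * mom 1 2 1 + e * mom 1 1 2 + f * mom 0 2 2 = v * w"
  shows "kernel_at u v w (qform a b c d e f)"
  by (rule kernel_atI, simp only: mult_qform_mom assms[symmetric]) Groebner_Basis.algebra

text \<open>
  The two kernels determine all moments except four: up to the masses \<open>1 / A\<close> at \<open>(1, 0, 0)\<close> and \<open>1 / D\<close>
  at \<open>(0, 1, 0)\<close>, \<open>L\<close> is carried by the intersection of \<open>x\<^sup>2 = z\<^sup>2\<close> and \<open>y\<^sup>2 = z\<^sup>2\<close>, which consists of the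
  four points \<open>(s, t, 1)\<close> with \<open>s, t = \<plusminus>1\<close>. The form \<open>(z + s x) (z + t y)\<close> vanishes at the other three points and at
  \<open>(1, 0, 0)\<close> and \<open>(0, 1, 0)\<close>, so the masses are positive. The kernels at \<open>(a, b, 0)\<close> and
  at \<open>(0, 0, 1)\<close> can then be written down, and their discriminants cannot all be 0.
\<close>

lemma nondegenerate_kernel_if_quadrangle:
  assumes K1: "kernel_at 1 0 0 (qform A 0 (-A) 0 0 0)"
    and K2: "kernel_at 0 1 0 (qform 0 D (-D) 0 0 0)"
  shows "\<exists>u v w q. kernel_at u v w q \<and> nondegenerate q"
proof (rule ccontr)
  assume N: "\<not> ?thesis"
  have A: "A > 0" using kernel_at_diag_pos[OF K1] by (simp add: qform_def)
  have D: "D > 0" using kernel_at_diag_pos[OF K2] by (simp add: qform_def)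
  define m n u v where "m = mom 0 0 4" and "n = mom 1 1 2" and "u = mom 1 0 3" and "v = mom 0 1 3"
  have k1: "L (\<lambda>x y z. qform A 0 (-A) 0 0 0 x y z * qform a b c d e f x y z) = a" for a b c d e f
    using kernel_atD[OF K1 quadratic_qform] by (simp add: qform_def)
  have k2: "L (\<lambda>x y z. qform 0 D (-D) 0 0 0 x y z * qform a b c d e f x y z) = b" for a b c d e f
    using kernel_atD[OF K2 quadratic_qform] by (simp add: qform_def)
  note k1' = k1[unfolded mult_qform_mom]
  note k2' = k2[unfolded mult_qform_mom]
  have 1: "A * mom 4 0 0 - A * mom 2 0 2 = 1" "A * (mom 2 2 0 - mom 0 2 2) = 0"
    "A * (mom 2 0 2 - mom 0 0 4) = 0" "A * (mom 3 1 0 - mom 1 1 2) = 0"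
    "A * (mom 3 0 1 - mom 1 0 3) = 0" "A * (mom 2 1 1 - mom 0 1 3) = 0"
    using k1'[of 1 0 0 0 0 0] k1'[of 0 1 0 0 0 0] k1'[of 0 0 1 0 0 0]
      k1'[of 0 0 0 1 0 0] k1'[of 0 0 0 0 1 0] k1'[of 0 0 0 0 0 1] by (auto simp: algebra_simps)
  have 2: "D * (mom 2 2 0 - mom 2 0 2) = 0" "D * mom 0 4 0 - D * mom 0 2 2 = 1"
    "D * (mom 0 2 2 - mom 0 0 4) = 0" "D * (mom 1 3 0 - mom 1 1 2) = 0"
    "D * (mom 1 2 1 - mom 1 0 3) = 0" "D * (mom 0 3 1 - mom 0 1 3) = 0"
    using k2'[of 1 0 0 0 0 0] k2'[of 0 1 0 0 0 0] k2'[of 0 0 1 0 0 0]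
      k2'[of 0 0 0 1 0 0] k2'[of 0 0 0 0 1 0] k2'[of 0 0 0 0 0 1] by (auto simp: algebra_simps)
  have M: "mom 2 0 2 = m" "mom 0 2 2 = m" "mom 2 2 0 = m" "mom 0 0 4 = m"
    "mom 3 1 0 = n" "mom 1 3 0 = n" "mom 1 1 2 = n" "mom 3 0 1 = u" "mom 1 2 1 = u" "mom 1 0 3 = u"
    "mom 2 1 1 = v" "mom 0 3 1 = v" "mom 0 1 3 = v"
    using 1 2 A D by (auto simp: m_def n_def u_def v_def)
  define X Y where "X = mom 4 0 0" and "Y = mom 0 4 0"
  have XY: "A * X = 1 + A * m" "D * Y = 1 + D * m"
    using 1(1) 2(2) by (auto simp: M X_def Y_def)
  note mom = mult_qform_mom[unfolded M, folded X_def Y_def]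
  \<comment> \<open>This quantity is four times the mass at \<open>(s, t, 1)\<close>.\<close>
  have W: "m + s * t * n + s * u + t * v > 0" if "s\<^sup>2 = 1" "t\<^sup>2 = 1" for s t
  proof -
    have "L (\<lambda>x y z. qform 0 0 1 (s * t) s t x y z * qform 0 0 1 (s * t) s t x y z) > 0"
      by (rule pos) (auto simp: qform_eq_0_iff)
    also have "L (\<lambda>x y z. qform 0 0 1 (s * t) s t x y z * qform 0 0 1 (s * t) s t x y z)
       = 4 * (m + s * t * n + s * u + t * v)"
      unfolding mom using that by Groebner_Basis.algebra
    finally show ?thesis by simp
  qed
  \<comment> \<open>The kernel at \<open>p\<close> is the sum of \<open>r(p) r / (mass)\<close> over the six points, with \<open>r\<close> equal to 1 at the point and 0
    at the others. For the four points with last coordinate 1 this is \<open>r = (z + s x) (z + t y) / 4\<close>. The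
    four coefficients \<open>1 / (16 mass)\<close> are \<open>k1\<close> to \<open>k4\<close>.\<close>
  define k1 k2 k3 k4 where "k1 = 1 / (4 * (m + n + u + v))" and "k2 = 1 / (4 * (m - n + u - v))"
    and "k3 = 1 / (4 * (m - n - u + v))" and "k4 = 1 / (4 * (m + n - u - v))"
  have kpos: "k1 > 0" "k2 > 0" "k3 > 0" "k4 > 0"
    using W[of 1 1] W[of 1 "-1"] W[of "-1" 1] W[of "-1" "-1"]
    by (auto simp: k1_def k2_def k3_def k4_def)
  have kW: "4 * k1 * (m + n + u + v) = 1" "4 * k2 * (m - n + u - v) = 1"
      "4 * k3 * (m - n - u + v) = 1" "4 * k4 * (m + n - u - v) = 1"
    using W[of 1 1] W[of 1 "-1"] W[of "-1" 1] W[of "-1" "-1"]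
    by (auto simp: k1_def k2_def k3_def k4_def)
  define P S U V where "P = k1 - k2 - k3 + k4" and "S = k1 + k2 + k3 + k4"
    and "U = k1 + k2 - k3 - k4" and "V = k1 - k2 + k3 - k4"
  have I: "P * m + S * n + V * u + U * v = 0" "P * n + S * m + V * v + U * u = 1"
    "P * u + S * v + V * m + U * n = 0" "P * v + S * u + V * n + U * m = 0"
    using kW unfolding P_def S_def U_def V_def by Groebner_Basis.algebra+
  have I': "S * m + P * n + U * u + V * v = 1" "S * n + P * m + U * v + V * u = 0"
    "S * u + P * v + U * m + V * n = 0" "S * v + P * u + U * n + V * m = 0"
    using kW unfolding P_def S_def U_def V_def by Groebner_Basis.algebra+
  \<comment> \<open>The discriminant of the kernel at \<open>(a, b, 0)\<close>, divided by \<open>(a * b)\<^sup>2\<close>. It is a quadratic form in \<open>a\<close>, \<open>b\<close>,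
    so its three coefficients vanish.\<close>
  have g: "(4 * A * D - S\<^sup>2) * (- A * a\<^sup>2 - D * b\<^sup>2 + a * b * P) + a * b * (S * U * V)
      - A * a\<^sup>2 * U\<^sup>2 - D * b\<^sup>2 * V\<^sup>2 = 0" if ab: "a \<noteq> 0" "b \<noteq> 0" for a b
  proof -
    let ?c = "- A * a\<^sup>2 - D * b\<^sup>2 + a * b * P"
    have J: "A * a\<^sup>2 * X = a\<^sup>2 + A * a\<^sup>2 * m" "D * b\<^sup>2 * Y = b\<^sup>2 + D * b\<^sup>2 * m"
      "a * b * (P * m + S * n + V * u + U * v) = 0" "a * b * (P * n + S * m + V * v + U * u) = a * b"
      "a * b * (P * u + S * v + V * m + U * n) = 0" "a * b * (P * v + S * u + V * n + U * m) = 0"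
      using XY unfolding I by Groebner_Basis.algebra+
    have "kernel_at a b 0 (qform (A * a\<^sup>2) (D * b\<^sup>2) ?c (a * b * S) (a * b * V) (a * b * U))"
      by (rule kernel_atI_mom, unfold M, fold X_def Y_def)
        (use J in \<open>simp_all add: algebra_simps\<close>)
    then have "\<not> nondegenerate (qform (A * a\<^sup>2) (D * b\<^sup>2) ?c (a * b * S) (a * b * V) (a * b * U))"
      using N by blast
    then have "disc (A * a\<^sup>2) (D * b\<^sup>2) ?c (a * b * S) (a * b * V) (a * b * U) = 0"
      unfolding nondegenerate_def by blast
    also have "disc (A * a\<^sup>2) (D * b\<^sup>2) ?c (a * b * S) (a * b * V) (a * b * U) = (a * b)\<^sup>2 *
      ((4 * A * D - S\<^sup>2) * ?c + a * b * (S * U * V) - A * a\<^sup>2 * U\<^sup>2 - D * b\<^sup>2 * V\<^sup>2)"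
      unfolding disc_def by Groebner_Basis.algebra
    finally show ?thesis using ab by simp
  qed
  have "kernel_at 0 0 1 (qform (-A) (-D) (A + D + S) P U V)"
    by (rule kernel_atI_mom, unfold M, fold X_def Y_def) 
      (use XY I' in \<open>simp_all add: algebra_simps\<close>)
  then have "\<not> nondegenerate (qform (-A) (-D) (A + D + S) P U V)" using N by blast
  then have g3: "disc (-A) (-D) (A + D + S) P U V = 0" unfolding nondegenerate_def by blast
  have UV: "U\<^sup>2 = V\<^sup>2" "4 * A * D - S\<^sup>2 = - (U\<^sup>2)" "- (U\<^sup>2) * P + S * U * V = 0"
  proof -
    let ?E = "4 * A * D - S\<^sup>2"
    have g': "?E * (- A - D + P) + S * U * V - A * U\<^sup>2 - D * V\<^sup>2 = 0"
      "?E * (- A - D - P) - S * U * V - A * U\<^sup>2 - D * V\<^sup>2 = 0"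
      "?E * (- A - 4 * D + 2 * P) + 2 * (S * U * V) - A * U\<^sup>2 - 4 * D * V\<^sup>2 = 0"
      using g[of 1 1] g[of 1 "-1"] g[of 1 2] by (simp_all add: mult.commute)
    then have "?E * P + S * U * V = 0" by Groebner_Basis.algebra
    moreover have "A * (?E + U\<^sup>2) + D * (?E + V\<^sup>2) = 0" using g' by Groebner_Basis.algebra
    moreover have "A * (?E + U\<^sup>2) + 4 * D * (?E + V\<^sup>2) = 0" using g' by Groebner_Basis.algebra
    ultimately have *: "D * (?E + V\<^sup>2) = 0" "A * (?E + U\<^sup>2) = 0" "?E * P + S * U * V = 0" by linarith+
    then show "?E = - (U\<^sup>2)" "U\<^sup>2 = V\<^sup>2" using A D by auto
    then show "- (U\<^sup>2) * P + S * U * V = 0" using *(3) by simp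
  qed
  have "\<bar>P\<bar> < S" using kpos by (auto simp: P_def S_def)
  then have SP: "S\<^sup>2 > P\<^sup>2" by (metis abs_ge_zero abs_of_nonneg order_less_imp_le order_trans power2_abs power_strict_mono pos2)
  have "U = 0"
  proof (rule ccontr)
    assume U: "U \<noteq> 0"
    have "(U\<^sup>2 * P)\<^sup>2 = (S * U * V)\<^sup>2" using UV(3) by simp
    then have "(U\<^sup>2)\<^sup>2 * P\<^sup>2 = (U\<^sup>2)\<^sup>2 * S\<^sup>2" using UV(1) by Groebner_Basis.algebra
    then show False using U SP by simp
  qed
  then have "V = 0" "4 * A * D = S\<^sup>2" using UV by auto
  then have "(A + D + S) * (S\<^sup>2 - P\<^sup>2) = 0" using g3 \<open>U = 0\<close> unfolding disc_def by Groebner_Basis.algebra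
  moreover have "S > 0" using kpos by (simp add: S_def)
  ultimately show False using SP A D by auto
qed

end

context quartic_functional
begin

lemma nondegenerate_kernel_lsub:
  assumes D: "det3 a b c d e f g h i \<noteq> 0"
    and M: "\<exists>u v w q. quartic_functional.kernel_at (\<lambda>F. L (lsub a b c d e f g h i F)) u v w q \<and> nondegenerate q"
  shows "\<exists>u v w q. kernel_at u v w q \<and> nondegenerate q"
proof -
  let ?S = "lsub a b c d e f g h i"
  interpret M: quartic_functional "\<lambda>F. L (?S F)"
    by (rule quartic_functional_lsub[OF D])
  obtain u v w q where q: "M.kernel_at u v w q" "nondegenerate q" using M by blast
  obtain a' b' c' d' e' f' g' h' i' where
    inv: "\<And>F. lsub a' b' c' d' e' f' g' h' i' (?S F) = F"
    using lsub_inverse[OF D] by metis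
  have inv': "lsub a' b' c' d' e' f' g' h' i' (?S F) u v w = F u v w" for F by (simp only: inv)
  let ?u = "a' * u + b' * v + c' * w" and ?v = "d' * u + e' * v + f' * w" and ?w = "g' * u + h' * v + i' * w"
  have "a * ?u + b * ?v + c * ?w = u" "d * ?u + e * ?v + f * ?w = v" "g * ?u + h * ?v + i * ?w = w"
    using inv'[of "\<lambda>x y z. x"] inv'[of "\<lambda>x y z. y"] inv'[of "\<lambda>x y z. z"] by (simp_all add: lsub_def)
  then have "kernel_at ?u ?v ?w (?S q)"
    using q(1) by (simp only: kernel_at_lsub[OF D])
  then show ?thesis using nondegenerate_lsub[OF D q(2)] by blast
qed

lemma mult_qform_add:
  "L (\<lambda>x y z. qform (a + t * a') (b + t * b') (c + t * c') (d + t * d') (e + t * e') (f + t * f') x y z * r x y z)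
   = L (\<lambda>x y z. qform a b c d e f x y z * r x y z) + t * L (\<lambda>x y z. qform a' b' c' d' e' f' x y z * r x y z)"
proof -
  have "(\<lambda>x y z. qform (a + t * a') (b + t * b') (c + t * c') (d + t * d') (e + t * e') (f + t * f') x y z * r x y z)
   = (\<lambda>x y z. qform a b c d e f x y z * r x y z + t * (qform a' b' c' d' e' f' x y z * r x y z))"
    by (intro ext) (simp add: qform_def algebra_simps)
  then show ?thesis by (simp only: add scale)
qed

text \<open>
  The lines \<open>x = z\<close> and \<open>x = -z\<close> meet at \<open>(0, 1, 0)\<close>. If the discriminant of the kernel is 0 along the
  curves \<open>(1, t, 0)\<close> and \<open>(1, 0, t)\<close>, then its derivative at \<open>t = 0\<close> shows that the kernel at \<open>(0, 1, 0)\<close> does not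
  involve \<open>x\<close>: it is a binary form in \<open>y\<close> and \<open>z\<close>. Positivity makes this form indefinite, and a substitution
  fixing \<open>x\<close> and \<open>z\<close> brings it to a multiple of \<open>y\<^sup>2 - z\<^sup>2\<close>.
\<close>

lemma nondegenerate_kernel_if_split:
  assumes K1: "kernel_at 1 0 0 (qform A 0 (-A) 0 0 0)"
  shows "\<exists>u v w q. kernel_at u v w q \<and> nondegenerate q"
proof (rule ccontr)
  assume N: "\<not> ?thesis"
  then have N: "disc a b c d e f = 0" if "kernel_at u v w (qform a b c d e f)" for u v w a b c d e f
    using that unfolding nondegenerate_def by blast
  have A: "A > 0" using kernel_at_diag_pos[OF K1] by (simp add: qform_def)
  have k1: "L (\<lambda>x y z. qform A 0 (-A) 0 0 0 x y z * qform a b c d e f x y z) = a" for a b c d e f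
    using kernel_atD[OF K1 quadratic_qform] by (simp add: qform_def)
  obtain a2 b2 c2 d2 e2 f2 where
    k2: "\<And>a b c d e f. L (\<lambda>x y z. qform a2 b2 c2 d2 e2 f2 x y z * qform a b c d e f x y z) = b"
    using riesz[of 0 1 0 0 0 0, simplified] by blast
  obtain a3 b3 c3 d3 e3 f3 where
    k3: "\<And>a b c d e f. L (\<lambda>x y z. qform a3 b3 c3 d3 e3 f3 x y z * qform a b c d e f x y z) = c"
    using riesz[of 0 0 1 0 0 0, simplified] by blast
  obtain a4 b4 c4 d4 e4 f4 where
    k4: "\<And>a b c d e f. L (\<lambda>x y z. qform a4 b4 c4 d4 e4 f4 x y z * qform a b c d e f x y z) = d"
    using riesz[of 0 0 0 1 0 0, simplified] by blast
  obtain a5 b5 c5 d5 e5 f5 where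
    k5: "\<And>a b c d e f. L (\<lambda>x y z. qform a5 b5 c5 d5 e5 f5 x y z * qform a b c d e f x y z) = e"
    using riesz[of 0 0 0 0 1 0, simplified] by blast
  \<comment> \<open>The dual forms have a symmetric coefficient matrix: each coefficient is a value \<open>L (p q)\<close>.\<close>
  have comm: "L (\<lambda>x y z. p x y z * q x y z) = L (\<lambda>x y z. q x y z * p x y z)" for p q
    by (simp only: mult.commute)
  have a2: "a2 = 0" using k1[of a2 b2 c2 d2 e2 f2] k2[of A 0 "-A" 0 0 0] comm by metis
  have a4: "a4 = 0" using k1[of a4 b4 c4 d4 e4 f4] k4[of A 0 "-A" 0 0 0] comm by metis
  have a5: "a5 = 0" using k1[of a5 b5 c5 d5 e5 f5] k5[of A 0 "-A" 0 0 0] comm by metis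
  have b4: "b4 = d2" using k2[of a4 b4 c4 d4 e4 f4] k4[of a2 b2 c2 d2 e2 f2] comm by metis
  have b5: "b5 = e2" using k2[of a5 b5 c5 d5 e5 f5] k5[of a2 b2 c2 d2 e2 f2] comm by metis
  have a3: "a3 = -A" using k1[of a3 b3 c3 d3 e3 f3] k3[of A 0 "-A" 0 0 0] comm by metis
  have b3: "b3 = c2" using k2[of a3 b3 c3 d3 e3 f3] k3[of a2 b2 c2 d2 e2 f2] comm by metis
  have "b4 = 0"
  proof -
    define h where "h t = 4 * A * (b4 + t * b2) * (- A + t * c4 + t\<^sup>2 * c2)
      + t\<^sup>2 * ((d4 + t * d2) * (e4 + t * e2) * (f4 + t * f2)) - A * t * (f4 + t * f2)\<^sup>2
      - t\<^sup>2 * ((b4 + t * b2) * (e4 + t * e2)\<^sup>2) - (- A + t * c4 + t\<^sup>2 * c2) * t * (d4 + t * d2)\<^sup>2" for t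
    have "h t = 0" if t: "t \<noteq> 0" for t
    proof -
      have "kernel_at 1 t 0 (qform ((A + t * a4) + t\<^sup>2 * a2) ((0 + t * b4) + t\<^sup>2 * b2) ((- A + t * c4) + t\<^sup>2 * c2)
          ((0 + t * d4) + t\<^sup>2 * d2) ((0 + t * e4) + t\<^sup>2 * e2) ((0 + t * f4) + t\<^sup>2 * f2))"
        by (rule kernel_atI) (simp only: mult_qform_add k1 k2 k4, simp)
      then have "disc ((A + t * a4) + t\<^sup>2 * a2) ((0 + t * b4) + t\<^sup>2 * b2) ((- A + t * c4) + t\<^sup>2 * c2)
          ((0 + t * d4) + t\<^sup>2 * d2) ((0 + t * e4) + t\<^sup>2 * e2) ((0 + t * f4) + t\<^sup>2 * f2) = 0"
        by (rule N)
      moreover have "disc ((A + t * a4) + t\<^sup>2 * a2) ((0 + t * b4) + t\<^sup>2 * b2) ((- A + t * c4) + t\<^sup>2 * c2)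
          ((0 + t * d4) + t\<^sup>2 * d2) ((0 + t * e4) + t\<^sup>2 * e2) ((0 + t * f4) + t\<^sup>2 * f2) = t * h t"
        unfolding disc_def h_def a2 a4 by (simp add: algebra_simps power2_eq_square)
      ultimately show ?thesis using t by simp
    qed
    moreover have "isCont h 0" unfolding h_def by (intro continuous_intros)
    ultimately have "h 0 = 0" by (rule continuous_eq_0_if_punctured[rotated])
    then show ?thesis using A by (simp add: h_def)
  qed
  have "b5 = 0"
  proof -
    define h where "h t = 4 * (A - t\<^sup>2 * A) * (b5 + t * c2) * (- A + t * c5 + t\<^sup>2 * c3)
      + t\<^sup>2 * ((d5 + t * d3) * (e5 + t * e3) * (f5 + t * f3)) - (A - t\<^sup>2 * A) * t * (f5 + t * f3)\<^sup>2
      - t\<^sup>2 * ((b5 + t * c2) * (e5 + t * e3)\<^sup>2) - (- A + t * c5 + t\<^sup>2 * c3) * t * (d5 + t * d3)\<^sup>2" for t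
    have "h t = 0" if t: "t \<noteq> 0" for t
    proof -
      have "kernel_at 1 0 t (qform ((A + t * a5) + t\<^sup>2 * a3) ((0 + t * b5) + t\<^sup>2 * b3) ((- A + t * c5) + t\<^sup>2 * c3)
          ((0 + t * d5) + t\<^sup>2 * d3) ((0 + t * e5) + t\<^sup>2 * e3) ((0 + t * f5) + t\<^sup>2 * f3))"
        by (rule kernel_atI) (simp only: mult_qform_add k1 k3 k5, simp)
      then have "disc ((A + t * a5) + t\<^sup>2 * a3) ((0 + t * b5) + t\<^sup>2 * b3) ((- A + t * c5) + t\<^sup>2 * c3)
          ((0 + t * d5) + t\<^sup>2 * d3) ((0 + t * e5) + t\<^sup>2 * e3) ((0 + t * f5) + t\<^sup>2 * f3) = 0"
        by (rule N)
      moreover have "disc ((A + t * a5) + t\<^sup>2 * a3) ((0 + t * b5) + t\<^sup>2 * b3) ((- A + t * c5) + t\<^sup>2 * c3)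
          ((0 + t * d5) + t\<^sup>2 * d3) ((0 + t * e5) + t\<^sup>2 * e3) ((0 + t * f5) + t\<^sup>2 * f3) = t * h t"
        unfolding disc_def h_def a5 a3 b3 by (simp add: algebra_simps power2_eq_square)
      ultimately show ?thesis using t by simp
    qed
    moreover have "isCont h 0" unfolding h_def by (intro continuous_intros)
    ultimately have "h 0 = 0" by (rule continuous_eq_0_if_punctured[rotated])
    then show ?thesis using A by (simp add: h_def)
  qed
  have K2: "kernel_at 0 1 0 (qform 0 b2 c2 0 0 f2)"
    using k2 \<open>b4 = 0\<close> \<open>b5 = 0\<close> b4 b5 a2 by (intro kernel_atI) simp
  have D: "b2 > 0" using kernel_at_diag_pos[OF K2] by (simp add: qform_def)
  \<comment> \<open>\<open>4 * b2\<close> times the kernel is \<open>(2 * b2 * y + f2 * z)\<^sup>2 + k * z\<^sup>2\<close>. Multiplied by \<open>x\<^sup>2\<close>, which vanishes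
    at \<open>(0, 1, 0)\<close>, it is annihilated by \<open>L\<close>, so it is not a sum of squares.\<close>
  define k where "k = 4 * b2 * c2 - f2\<^sup>2"
  have k: "k < 0"
  proof (rule ccontr)
    assume "\<not> k < 0"
    have "L (\<lambda>x y z. qform 0 0 0 (2 * b2) f2 0 x y z * qform 0 0 0 (2 * b2) f2 0 x y z) > 0"
      using D by (intro pos) (auto simp: qform_eq_0_iff)
    moreover have "L (\<lambda>x y z. qform 0 0 0 0 1 0 x y z * qform 0 0 0 0 1 0 x y z) > 0"
      by (intro pos) (auto simp: qform_eq_0_iff)
    moreover have "4 * b2 * L (\<lambda>x y z. qform 0 b2 c2 0 0 f2 x y z * qform 1 0 0 0 0 0 x y z) =
      L (\<lambda>x y z. qform 0 0 0 (2 * b2) f2 0 x y z * qform 0 0 0 (2 * b2) f2 0 x y z)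
      + k * L (\<lambda>x y z. qform 0 0 0 0 1 0 x y z * qform 0 0 0 0 1 0 x y z)"
      unfolding mult_qform_mom k_def by Groebner_Basis.algebra
    moreover have "L (\<lambda>x y z. qform 0 b2 c2 0 0 f2 x y z * qform 1 0 0 0 0 0 x y z) = 0"
      using kernel_atD[OF K2 quadratic_qform[of 1 0 0 0 0 0]] by (simp add: qform_def)
    moreover have "k * L (\<lambda>x y z. qform 0 0 0 0 1 0 x y z * qform 0 0 0 0 1 0 x y z) \<ge> 0"
      using calculation(2) \<open>\<not> k < 0\<close> by simp
    ultimately show False by simp
  qed
  define \<omega> where "\<omega> = - k / (4 * b2)"
  have \<omega>: "\<omega> > 0" "4 * b2 * \<omega> = - k" using k D by (auto simp: \<omega>_def divide_neg_pos)
  define \<mu> where "\<mu> = sqrt (b2 / \<omega>)"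
  have \<mu>: "\<mu> > 0" "\<omega> * \<mu>\<^sup>2 = b2" using \<omega> D by (auto simp: \<mu>_def)
  define \<nu> where "\<nu> = \<mu> * f2 / (2 * b2)"
  have \<nu>: "2 * b2 * \<nu> = \<mu> * f2" using D by (simp add: \<nu>_def)
  have "det3 1 0 0 0 \<mu> \<nu> 0 0 1 \<noteq> 0" using \<mu> by (simp add: det3_def)
  note det = this
  interpret M: quartic_functional "\<lambda>F. L (lsub 1 0 0 0 \<mu> \<nu> 0 0 1 F)"
    by (rule quartic_functional_lsub[OF det])
  have "lsub 1 0 0 0 \<mu> \<nu> 0 0 1 (qform A 0 (-A) 0 0 0) = qform A 0 (-A) 0 0 0"
    by (simp add: lsub_qform)
  then have M1: "M.kernel_at 1 0 0 (qform A 0 (-A) 0 0 0)"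
    using K1 kernel_at_lsub[OF det, of 1 0 0 "qform A 0 (-A) 0 0 0"] by simp
  have "2 * \<omega> * \<mu> * \<nu> = f2"
  proof -
    have "b2 * (2 * \<omega> * \<mu> * \<nu>) = (\<omega> * \<mu>) * (2 * b2 * \<nu>)" by Groebner_Basis.algebra
    also have "\<dots> = (\<omega> * \<mu>\<^sup>2) * f2" unfolding \<nu> by Groebner_Basis.algebra
    also have "\<dots> = b2 * f2" by (simp only: \<mu>(2))
    finally show ?thesis using D by simp
  qed
  moreover have "\<omega> * \<nu>\<^sup>2 - \<omega> = c2"
  proof -
    have "4 * b2 * (\<omega> * \<nu>\<^sup>2 - \<omega>) = (2 * \<omega> * \<mu> * \<nu>) * (2 * b2 * \<nu>) / \<mu> - 4 * b2 * \<omega>"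
      using \<mu>(1) by (simp add: field_simps power2_eq_square)
    also have "\<dots> = 4 * b2 * c2"
      unfolding \<nu> \<open>2 * \<omega> * \<mu> * \<nu> = f2\<close> \<omega>(2) using \<mu>(1) by (simp add: k_def power2_eq_square)
    finally show ?thesis using D by simp
  qed
  ultimately have "lsub 1 0 0 0 \<mu> \<nu> 0 0 1 (qform 0 \<omega> (-\<omega>) 0 0 0) = qform 0 b2 c2 0 0 f2"
    unfolding lsub_qform qform_eq_iff using \<mu>(2) by simp
  then have "M.kernel_at 0 \<mu> 0 (qform 0 \<omega> (-\<omega>) 0 0 0)"
    using K2 kernel_at_lsub[OF det, of 0 1 0 "qform 0 \<omega> (-\<omega>) 0 0 0"] by simp
  from M.kernel_at_scale[OF this, of "1 / \<mu>"]
  have "M.kernel_at 0 1 0 (qform 0 (\<omega> / \<mu>\<^sup>2) (- (\<omega> / \<mu>\<^sup>2)) 0 0 0)"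
    using \<mu>(1) by (simp add: power_divide)
  from M.nondegenerate_kernel_if_quadrangle[OF M1 this]
  have "\<exists>u v w q. kernel_at u v w q \<and> nondegenerate q"
    by (rule nondegenerate_kernel_lsub[OF det])
  then show False using N unfolding nondegenerate_def by blast
qed

text \<open>
  The kernel at \<open>(1, 0, 0)\<close>, if degenerate, becomes \<open>a (X\<^sup>2 \<plusminus> \<ell>\<^sup>2)\<close> after completing the square, where the
  linear form \<open>\<ell>\<close> involves only \<open>y\<close> and \<open>z\<close>. The sign \<open>+\<close> and \<open>\<ell> = 0\<close> are impossible: \<open>y\<^sup>2\<close> times the kernel, which \<open>L\<close> annihilates, would be a
  sum of squares.
\<close>

lemma exists_nondegenerate_kernel: "\<exists>u v w q. kernel_at u v w q \<and> nondegenerate q"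
proof -
  obtain q where q: "kernel_at 1 0 0 q" using kernel_exists[of 1 0 0] by blast
  then have "quadratic q" by (simp add: kernel_at_def)
  then obtain a b c d e f where qe: "q = qform a b c d e f"
    unfolding quadratic_def by blast
  have K: "kernel_at 1 0 0 (qform a b c d e f)" using q by (simp only: qe)
  have a: "a > 0" using kernel_at_diag_pos[OF K] by (simp add: qform_def)
  show ?thesis
  proof (cases "disc a b c d e f = 0")
    case False
    then show ?thesis using K unfolding nondegenerate_def by blast
  next
    case True
    \<comment> \<open>\<open>4 * a * q = (2 * a * x + d * y + e * z)\<^sup>2 + \<alpha> * y\<^sup>2 + \<beta> * y * z + \<gamma> * z\<^sup>2\<close>\<close>
    define \<alpha> \<beta> \<gamma> where "\<alpha> = 4 * a * b - d\<^sup>2" and "\<beta> = 4 * a * f - 2 * d * e" and "\<gamma> = 4 * a * c - e\<^sup>2"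
    have "\<beta>\<^sup>2 - 4 * \<alpha> * \<gamma> = - 16 * a * disc a b c d e f"
      unfolding \<alpha>_def \<beta>_def \<gamma>_def disc_def by Groebner_Basis.algebra
    then have \<beta>: "\<beta>\<^sup>2 = 4 * \<alpha> * \<gamma>" using True by simp
    have neg: "\<not> (\<alpha> \<ge> 0 \<and> \<gamma> \<ge> 0)"
    proof
      assume nn: "\<alpha> \<ge> 0 \<and> \<gamma> \<ge> 0"
      obtain \<sigma> \<tau> where st: "\<alpha> = \<sigma>\<^sup>2" "\<gamma> = \<tau>\<^sup>2" "\<beta> = 2 * \<sigma> * \<tau>"
        by (rule binary_square[of \<alpha> \<gamma> \<beta>]) (use nn \<beta> in simp_all)
      have st': "\<sigma> * \<sigma> = 4 * a * b - d * d" "\<tau> * \<tau> = 4 * a * c - e * e"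
        "\<sigma> * \<tau> + \<tau> * \<sigma> = 4 * a * f - 2 * d * e"
        using st unfolding \<alpha>_def \<beta>_def \<gamma>_def by (simp_all add: power2_eq_square)
      have "L (\<lambda>x y z. qform 0 d 0 (2 * a) 0 e x y z * qform 0 d 0 (2 * a) 0 e x y z) > 0"
        using a by (intro pos) (auto simp: qform_eq_0_iff)
      moreover have "L (\<lambda>x y z. qform 0 \<sigma> 0 0 0 \<tau> x y z * qform 0 \<sigma> 0 0 0 \<tau> x y z) \<ge> 0"
      proof (cases "\<sigma> = 0 \<and> \<tau> = 0")
        case True
        then show ?thesis by (simp add: qform_def zero)
      next
        case False
        then show ?thesis by (intro less_imp_le pos) (auto simp: qform_eq_0_iff)
      qed
      moreover have "4 * a * L (\<lambda>x y z. qform a b c d e f x y z * qform 0 1 0 0 0 0 x y z) =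
        L (\<lambda>x y z. qform 0 d 0 (2 * a) 0 e x y z * qform 0 d 0 (2 * a) 0 e x y z)
        + L (\<lambda>x y z. qform 0 \<sigma> 0 0 0 \<tau> x y z * qform 0 \<sigma> 0 0 0 \<tau> x y z)"
        unfolding mult_qform_mom st' by (simp add: algebra_simps)
      moreover have "L (\<lambda>x y z. qform a b c d e f x y z * qform 0 1 0 0 0 0 x y z) = 0"
        using kernel_atD[OF K quadratic_qform[of 0 1 0 0 0 0]] by (simp add: qform_def)
      ultimately show False by simp
    qed
    have "\<alpha> * \<gamma> \<ge> 0" using zero_le_power2[of \<beta>] \<beta> by simp
    then have "- \<alpha> \<ge> 0 \<and> - \<gamma> \<ge> 0" using neg by (auto simp: zero_le_mult_iff)
    then have "- \<alpha> \<ge> 0" "- \<gamma> \<ge> 0" by blast+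
    moreover have "(- \<beta>)\<^sup>2 = 4 * (- \<alpha>) * (- \<gamma>)" using \<beta> by simp
    ultimately obtain \<sigma> \<tau> where st: "- \<alpha> = \<sigma>\<^sup>2" "- \<gamma> = \<tau>\<^sup>2" "- \<beta> = 2 * \<sigma> * \<tau>"
      by (rule binary_square)
    have "\<sigma>\<^sup>2 + \<tau>\<^sup>2 \<noteq> 0"
    proof
      assume "\<sigma>\<^sup>2 + \<tau>\<^sup>2 = 0"
      then have "\<sigma>\<^sup>2 = 0" "\<tau>\<^sup>2 = 0" by (simp_all add: sum_power2_eq_zero_iff)
      then show False using neg st by simp
    qed
    define D E S T where "D = d / (2 * a)" and "E = e / (2 * a)" and "S = \<sigma> / (2 * a)" and "T = \<tau> / (2 * a)"
    have DEST: "d = 2 * a * D" "e = 2 * a * E" "\<sigma> = 2 * a * S" "\<tau> = 2 * a * T"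
      using a by (simp_all add: D_def E_def S_def T_def)
    have "det3 1 D E 0 \<tau> (-\<sigma>) 0 S T = 2 * a * (S\<^sup>2 + T\<^sup>2)"
      by (simp add: det3_def DEST power2_eq_square algebra_simps)
    moreover have "S\<^sup>2 + T\<^sup>2 \<noteq> 0" using \<open>\<sigma>\<^sup>2 + \<tau>\<^sup>2 \<noteq> 0\<close> by (auto simp: DEST)
    ultimately have det: "det3 1 D E 0 \<tau> (-\<sigma>) 0 S T \<noteq> 0" using a by simp
    interpret M: quartic_functional "\<lambda>F. L (lsub 1 D E 0 \<tau> (-\<sigma>) 0 S T F)"
      by (rule quartic_functional_lsub[OF det])
    have "4 * a * (a * D\<^sup>2 - a * S\<^sup>2) = 4 * a * b" "4 * a * (a * E\<^sup>2 - a * T\<^sup>2) = 4 * a * c"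
      "4 * a * (2 * a * (D * E) - 2 * a * (S * T)) = 4 * a * f"
      using st unfolding \<alpha>_def \<beta>_def \<gamma>_def DEST by Groebner_Basis.algebra+
    then have "a * D\<^sup>2 - a * S\<^sup>2 = b" "a * E\<^sup>2 - a * T\<^sup>2 = c"
      "2 * a * (D * E) - 2 * a * (S * T) = f"
      using a by auto
    then have "lsub 1 D E 0 \<tau> (-\<sigma>) 0 S T (qform a 0 (-a) 0 0 0) = qform a b c d e f"
      by (simp add: lsub_qform DEST algebra_simps)
    then have "M.kernel_at 1 0 0 (qform a 0 (-a) 0 0 0)"
      using K kernel_at_lsub[OF det, of 1 0 0 "qform a 0 (-a) 0 0 0"] by simp
    from M.nondegenerate_kernel_if_split[OF this] show ?thesis
      by (rule nondegenerate_kernel_lsub[OF det])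
  qed
qed

text \<open>
  The discriminant depends continuously on the point, so a point with \<open>x = 0\<close> can be moved
  to one with \<open>x \<noteq> 0\<close>, and by homogeneity to one with \<open>x = 1\<close>.
\<close>

lemma exists_affine_nondegenerate_kernel: "\<exists>v w q. kernel_at 1 v w q \<and> nondegenerate q"
proof -
  have *: ?thesis if u: "u \<noteq> 0" and q: "kernel_at u v w (qform a b c d e f)" "disc a b c d e f \<noteq> 0"
    for u v w a b c d e f
  proof -
    have "kernel_at 1 (v / u) (w / u) (qform ((1 / u)\<^sup>2 * a) ((1 / u)\<^sup>2 * b) ((1 / u)\<^sup>2 * c)
        ((1 / u)\<^sup>2 * d) ((1 / u)\<^sup>2 * e) ((1 / u)\<^sup>2 * f))"
      using kernel_at_scale[OF q(1), of "1 / u"] u by simp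
    moreover have "disc ((1 / u)\<^sup>2 * a) ((1 / u)\<^sup>2 * b) ((1 / u)\<^sup>2 * c) ((1 / u)\<^sup>2 * d) ((1 / u)\<^sup>2 * e) ((1 / u)\<^sup>2 * f)
        = (1 / u) ^ 6 * disc a b c d e f"
      unfolding disc_def by Groebner_Basis.algebra
    ultimately show ?thesis using q(2) u unfolding nondegenerate_def
      by (intro exI conjI) (assumption, rule refl, simp)
  qed
  obtain u v w q0 where q0: "kernel_at u v w q0" "nondegenerate q0"
    using exists_nondegenerate_kernel by blast
  then obtain a b c d e f where qe: "q0 = qform a b c d e f" and q2: "disc a b c d e f \<noteq> 0"
    unfolding nondegenerate_def by blast
  note q = q0(1)[unfolded qe] q2
  show ?thesis
  proof (cases "u = 0")
    case False
    then show ?thesis using *[OF False q] by simp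
  next
    case True
    obtain a1 b1 c1 d1 e1 f1 where
      k1: "\<And>a b c d e f. L (\<lambda>x y z. qform a1 b1 c1 d1 e1 f1 x y z * qform a b c d e f x y z) = d * v + e * w"
      using riesz[of 0 0 0 v w 0, simplified] by blast
    obtain a2 b2 c2 d2 e2 f2 where
      k2: "\<And>a b c d e f. L (\<lambda>x y z. qform a2 b2 c2 d2 e2 f2 x y z * qform a b c d e f x y z) = a"
      using riesz[of 1 0 0 0 0 0, simplified] by blast
    have k0: "L (\<lambda>x y z. qform a b c d e f x y z * qform a' b' c' d' e' f' x y z)
      = b' * v\<^sup>2 + c' * w\<^sup>2 + f' * (v * w)" for a' b' c' d' e' f'
      using kernel_atD[OF q(1) quadratic_qform] True by (simp add: qform_def)
    define h where "h t = disc (a + t * a1 + t\<^sup>2 * a2) (b + t * b1 + t\<^sup>2 * b2) (c + t * c1 + t\<^sup>2 * c2)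
       (d + t * d1 + t\<^sup>2 * d2) (e + t * e1 + t\<^sup>2 * e2) (f + t * f1 + t\<^sup>2 * f2)" for t
    have "isCont h 0" unfolding h_def disc_def by (intro continuous_intros)
    moreover have "h 0 \<noteq> 0" using q(2) by (simp add: h_def)
    ultimately obtain t where t: "t \<noteq> 0" "h t \<noteq> 0" using continuous_eq_0_if_punctured[of h] by blast
    have "kernel_at t v w (qform (a + t * a1 + t\<^sup>2 * a2) (b + t * b1 + t\<^sup>2 * b2) (c + t * c1 + t\<^sup>2 * c2)
       (d + t * d1 + t\<^sup>2 * d2) (e + t * e1 + t\<^sup>2 * e2) (f + t * f1 + t\<^sup>2 * f2))"
      by (rule kernel_atI) (simp only: mult_qform_add k0 k1 k2, simp add: algebra_simps)
    from *[OF t(1) this] t(2) show ?thesis by (simp add: h_def)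
  qed
qed

end

section \<open>Six atoms from a nondegenerate kernel\<close>

context quartic_functional
begin

text \<open>
  Representation by six point evaluations with positive masses, none of the points on the line
  \<open>\<alpha> x + \<beta> y + \<gamma> z = 0\<close>. The line matters because the line at infinity \<open>x = 0\<close> has to be avoided and is moved by
  linear substitutions.
\<close>

definition six_atoms_off :: "real \<Rightarrow> real \<Rightarrow> real \<Rightarrow> bool" where
  "six_atoms_off \<alpha> \<beta> \<gamma> \<longleftrightarrow> (\<exists>X Y Z \<rho>.
     (\<forall>i<6. \<rho> i > 0 \<and> \<alpha> * X i + \<beta> * Y i + \<gamma> * Z i \<noteq> 0) \<and>
     (\<forall>r s. quadratic r \<longrightarrow> quadratic s \<longrightarrow> L (\<lambda>x y z. r x y z * s x y z) =
       (\<Sum>i<(6::nat). \<rho> i * (r (X i) (Y i) (Z i) * s (X i) (Y i) (Z i)))))"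

lemma six_atoms_off_lsub:
  assumes D: "det3 a b c d e f g h i \<noteq> 0"
    and M: "quartic_functional.six_atoms_off (\<lambda>F. L (lsub a b c d e f g h i F)) \<alpha> \<beta> \<gamma>"
  shows "six_atoms_off (\<alpha> * a + \<beta> * d + \<gamma> * g) (\<alpha> * b + \<beta> * e + \<gamma> * h) (\<alpha> * c + \<beta> * f + \<gamma> * i)"
proof -
  let ?S = "lsub a b c d e f g h i"
  interpret M: quartic_functional "\<lambda>F. L (?S F)"
    by (rule quartic_functional_lsub[OF D])
  obtain X Y Z \<rho> where pos: "\<And>j. j < 6 \<Longrightarrow> \<rho> j > 0 \<and> \<alpha> * X j + \<beta> * Y j + \<gamma> * Z j \<noteq> 0"
    and repr: "\<And>r s. quadratic r \<Longrightarrow> quadratic s \<Longrightarrow> L (?S (\<lambda>x y z. r x y z * s x y z)) =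
       (\<Sum>j<(6::nat). \<rho> j * (r (X j) (Y j) (Z j) * s (X j) (Y j) (Z j)))"
    using M unfolding M.six_atoms_off_def by blast
  obtain a' b' c' d' e' f' g' h' i' where
    inv: "\<And>F. ?S (lsub a' b' c' d' e' f' g' h' i' F) = F"
      "\<And>F. lsub a' b' c' d' e' f' g' h' i' (?S F) = F"
    by (rule lsub_inverse[OF D]) blast
  let ?T = "lsub a' b' c' d' e' f' g' h' i'"
  let ?X = "\<lambda>j. a' * X j + b' * Y j + c' * Z j" and ?Y = "\<lambda>j. d' * X j + e' * Y j + f' * Z j"
    and ?Z = "\<lambda>j. g' * X j + h' * Y j + i' * Z j"
  have inv': "?T (?S F) (X j) (Y j) (Z j) = F (X j) (Y j) (Z j)" for F j by (simp only: inv)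
  have "(\<alpha> * a + \<beta> * d + \<gamma> * g) * ?X j + (\<alpha> * b + \<beta> * e + \<gamma> * h) * ?Y j + (\<alpha> * c + \<beta> * f + \<gamma> * i) * ?Z j
      = \<alpha> * X j + \<beta> * Y j + \<gamma> * Z j" for j
  proof -
    have "?T (?S (\<lambda>x y z. \<alpha> * x + \<beta> * y + \<gamma> * z)) (X j) (Y j) (Z j) = \<alpha> * X j + \<beta> * Y j + \<gamma> * Z j"
      by (simp only: inv)
    then show ?thesis by (simp add: lsub_def algebra_simps)
  qed
  moreover have "L (\<lambda>x y z. r x y z * s x y z) =
     (\<Sum>j<(6::nat). \<rho> j * (r (?X j) (?Y j) (?Z j) * s (?X j) (?Y j) (?Z j)))"
    if "quadratic r" "quadratic s" for r s
  proof -
    have "?S (\<lambda>x y z. ?T r x y z * ?T s x y z) = (\<lambda>x y z. ?S (?T r) x y z * ?S (?T s) x y z)"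
      by (simp add: lsub_def)
    then have "L (\<lambda>x y z. r x y z * s x y z) = L (?S (\<lambda>x y z. ?T r x y z * ?T s x y z))"
      by (simp only: inv)
    also have "\<dots> = (\<Sum>j<(6::nat). \<rho> j * (?T r (X j) (Y j) (Z j) * ?T s (X j) (Y j) (Z j)))"
      using that by (intro repr quadratic_lsub)
    finally show ?thesis by (simp add: lsub_def)
  qed
  ultimately show ?thesis
    unfolding six_atoms_off_def using pos
    by (intro exI[of _ ?X] exI[of _ ?Y] exI[of _ ?Z] exI[of _ \<rho>]) auto
qed

text \<open>
  With \<open>c\<close> the reciprocal of the value of the kernel \<open>q\<close> at its own point, \<open>L\<close> minus \<open>c\<close> times the evaluation there annihilates
  all multiples of \<open>q\<close>. So it sees quartic forms only through their values at the points \<open>(t\<^sup>2, t, 1)\<close> of the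
  conic \<open>x z = y\<^sup>2\<close>, which are polynomials in \<open>t\<close> of degree at most 8.
\<close>

lemma six_atoms_if_parametrized_conic:
  assumes K: "kernel_at u v w (qform 0 (-k) 0 0 k 0)" and k: "k \<noteq> 0"
    and h: "h1 * u + h2 * v + h3 * w \<noteq> 0"
  shows "six_atoms_off h1 h2 h3"
proof -
  define q where "q = qform 0 (-k) 0 0 k 0"
  have q: "quadratic q" by (simp add: q_def)
  have Kq: "kernel_at u v w q" using K by (simp add: q_def)
  have "(u, v, w) \<noteq> (0, 0, 0)" using h by auto
  then have qpos: "q u v w > 0" by (rule kernel_at_diag_pos[OF Kq])
  define c where "c = 1 / q u v w"
  have c: "c > 0" "c * (q u v w) = 1" using qpos by (auto simp: c_def)
  define m where "m i j l = mom i j l - c * (u ^ i * v ^ j * w ^ l)" for i j l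
  have mom: "mom i j l = m i j l + c * (u ^ i * v ^ j * w ^ l)" for i j l by (simp add: m_def)
  have qr: "k * (a * (m 3 0 1 - m 2 2 0) + b * (m 1 2 1 - m 0 4 0) + d * (m 1 0 3 - m 0 2 2)
      + e * (m 2 1 1 - m 1 3 0) + f * (m 2 0 2 - m 1 2 1) + g * (m 1 1 2 - m 0 3 1)) = 0" for a b d e f g
  proof -
    have "L (\<lambda>x y z. q x y z * qform a b d e f g x y z) = qform a b d e f g u v w"
      by (rule kernel_atD[OF Kq]) simp
    also have "\<dots> = c * q u v w * qform a b d e f g u v w" using c by simp
    finally show ?thesis
      unfolding q_def mult_qform_mom mom by (simp add: qform_def algebra_simps eval_nat_numeral)
  qed
  have rel: "m 2 2 0 = m 3 0 1" "m 1 2 1 = m 0 4 0" "m 0 2 2 = m 1 0 3" "m 1 3 0 = m 2 1 1"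
    "m 2 0 2 = m 0 4 0" "m 0 3 1 = m 1 1 2"
    using qr[of 1 0 0 0 0 0] qr[of 0 1 0 0 0 0] qr[of 0 0 1 0 0 0] qr[of 0 0 0 1 0 0]
      qr[of 0 0 0 0 1 0] qr[of 0 0 0 0 0 1] k by auto
  define \<Lambda> where "\<Lambda> p = coeff p 0 * m 0 0 4 + coeff p 1 * m 0 1 3 + coeff p 2 * m 1 0 3
    + coeff p 3 * m 1 1 2 + coeff p 4 * m 0 4 0 + coeff p 5 * m 2 1 1 + coeff p 6 * m 3 0 1
    + coeff p 7 * m 3 1 0 + coeff p 8 * m 4 0 0" for p :: "real poly"
  have LL: "L (\<lambda>x y z. qform a b d e f g x y z * qform a' b' d' e' f' g' x y z)
      = c * (qform a b d e f g u v w * qform a' b' d' e' f' g' u v w)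
        + \<Lambda> ([:d, g, b + f, e, a:] * [:d', g', b' + f', e', a':])" for a b d e f g a' b' d' e' f' g'
  proof -
    have "\<Lambda> ([:d, g, b + f, e, a:] * [:d', g', b' + f', e', a':]) =
      (a * a') * m 4 0 0 + (b * b') * m 0 4 0 + (d * d') * m 0 0 4
    + (a * e' + e * a') * m 3 1 0 + (a * f' + f * a') * m 3 0 1
    + (b * e' + e * b') * m 2 1 1 + (b * g' + g * b') * m 1 1 2
    + (d * f' + f * d') * m 1 0 3 + (d * g' + g * d') * m 0 1 3
    + (a * b' + b * a' + e * e') * m 3 0 1 + (a * d' + d * a' + f * f') * m 0 4 0
    + (b * d' + d * b' + g * g') * m 1 0 3
    + (a * g' + g * a' + e * f' + f * e') * m 2 1 1
    + (b * f' + f * b' + e * g' + g * e') * m 0 4 0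
    + (d * e' + e * d' + f * g' + g * f') * m 1 1 2"
      by (simp add: \<Lambda>_def eval_nat_numeral algebra_simps)
    moreover have "L (\<lambda>x y z. qform a b d e f g x y z * qform a' b' d' e' f' g' x y z)
      = c * (qform a b d e f g u v w * qform a' b' d' e' f' g' u v w)
      + ((a * a') * m 4 0 0 + (b * b') * m 0 4 0 + (d * d') * m 0 0 4
    + (a * e' + e * a') * m 3 1 0 + (a * f' + f * a') * m 3 0 1
    + (b * e' + e * b') * m 2 1 1 + (b * g' + g * b') * m 1 1 2
    + (d * f' + f * d') * m 1 0 3 + (d * g' + g * d') * m 0 1 3
    + (a * b' + b * a' + e * e') * m 3 0 1 + (a * d' + d * a' + f * f') * m 0 4 0
    + (b * d' + d * b' + g * g') * m 1 0 3
    + (a * g' + g * a' + e * f' + f * e') * m 2 1 1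
    + (b * f' + f * b' + e * g' + g * e') * m 0 4 0
    + (d * e' + e * d' + f * g' + g * f') * m 1 1 2)"
      unfolding mult_qform_mom mom rel by (simp add: qform_def algebra_simps eval_nat_numeral)
    ultimately show ?thesis by simp
  qed
  interpret P: positive_poly_functional \<Lambda> 4
  proof
    fix p p' :: "real poly" and x :: real
    show "\<Lambda> (p + p') = \<Lambda> p + \<Lambda> p'" "\<Lambda> (smult x p) = x * \<Lambda> p"
      by (simp_all add: \<Lambda>_def algebra_simps)
    assume p: "p \<noteq> 0" "degree p \<le> 4"
    define g0 g1 g2 g3 g4 where "g0 = coeff p 0" and "g1 = coeff p 1" and "g2 = coeff p 2"
      and "g3 = coeff p 3" and "g4 = coeff p 4"
    have pe: "p = [:g0, g1, 0 + g2, g3, g4:]"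
      by (rule poly_eqI)
        (use p(2) in \<open>auto simp: coeff_pCons g0_def g1_def g2_def g3_def g4_def coeff_eq_0 eval_nat_numeral split: nat.splits\<close>)
    \<comment> \<open>The lift of \<open>p\<close> without a \<open>y\<^sup>2\<close> term. The remainder of \<open>G\<close> after orthogonal projection onto \<open>q\<close> is
      nonzero because only \<open>q\<close> has a \<open>y\<^sup>2\<close> term, and its square norm is \<open>\<Lambda> (p\<^sup>2)\<close>.\<close>
    define G where "G = qform g4 0 g0 g3 g2 g1"
    define t where "t = - c * G u v w"
    define G' where "G' = qform (g4 + t * 0) (0 + t * (-k)) (g0 + t * 0) (g3 + t * 0) (g2 + t * k) (g1 + t * 0)"
    have "G' \<noteq> (\<lambda>x y z. 0)"
    proof
      assume "G' = (\<lambda>x y z. 0)"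
      then have "p = 0" using k by (auto simp: G'_def qform_eq_0_iff pe)
      then show False using p by simp
    qed
    then have "L (\<lambda>x y z. G' x y z * G' x y z) > 0" by (intro pos) (simp add: G'_def)
    also have "L (\<lambda>x y z. G' x y z * G' x y z) =
      L (\<lambda>x y z. G x y z * G' x y z) + t * L (\<lambda>x y z. q x y z * G' x y z)"
      unfolding G'_def q_def G_def by (rule mult_qform_add)
    also have "L (\<lambda>x y z. q x y z * G' x y z) = G' u v w"
      by (rule kernel_atD[OF Kq]) (simp add: G'_def)
    also have "G' u v w = G u v w + t * q u v w"
      by (simp add: G'_def G_def q_def qform_def algebra_simps)
    also have "\<dots> = 0" using c(2) by (simp add: t_def algebra_simps)
    also have "L (\<lambda>x y z. G x y z * G' x y z) = L (\<lambda>x y z. G' x y z * G x y z)"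
      by (simp only: mult.commute)
    also have "\<dots> = L (\<lambda>x y z. G x y z * G x y z) + t * L (\<lambda>x y z. q x y z * G x y z)"
      unfolding G'_def q_def by (subst (2) G_def, rule mult_qform_add)
    also have "L (\<lambda>x y z. q x y z * G x y z) = G u v w"
      by (rule kernel_atD[OF Kq]) (simp add: G_def)
    also have "L (\<lambda>x y z. G x y z * G x y z) = c * (G u v w * G u v w) + \<Lambda> (p * p)"
      unfolding pe G_def by (rule LL)
    finally show "\<Lambda> (p * p) > 0" by (simp add: t_def algebra_simps)
  qed
  have "[:h3, h2, h1:] \<noteq> 0" using h by auto
  then have "finite {t. poly [:h3, h2, h1:] t = 0}" by (rule poly_roots_finite)
  then obtain T \<omega> where T: "finite T" "card T = 5" "T \<inter> {t. poly [:h3, h2, h1:] t = 0} = {}"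
    and \<omega>: "\<And>t. t \<in> T \<Longrightarrow> \<omega> t > 0"
    and quad: "\<And>p. degree p \<le> 8 \<Longrightarrow> \<Lambda> p = (\<Sum>t\<in>T. \<omega> t * poly p t)"
    using P.quadrature_avoiding[of "{t. poly [:h3, h2, h1:] t = 0}"] by auto
  obtain \<tau> where \<tau>: "bij_betw \<tau> {..<5::nat} T"
    using ex_bij_betw_nat_finite[OF T(1)] T(2) by (auto simp: atLeast0LessThan)
  define X where "X i = (if i = 5 then u else (\<tau> i)\<^sup>2)" for i
  define Y where "Y i = (if i = 5 then v else \<tau> i)" for i
  define Z where "Z i = (if i = 5 then w else 1)" for i :: nat
  define \<rho> where "\<rho> i = (if i = 5 then c else \<omega> (\<tau> i))" for i
  have \<tau>T: "\<tau> i \<in> T" if "i < 5" for i using \<tau> that by (auto simp: bij_betw_def)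
  have "\<rho> i > 0 \<and> h1 * X i + h2 * Y i + h3 * Z i \<noteq> 0" if "i < 6" for i
  proof (cases "i = 5")
    case True
    then show ?thesis using c h by (simp add: \<rho>_def X_def Y_def Z_def)
  next
    case False
    then have i: "i < 5" using that by simp
    have "poly [:h3, h2, h1:] (\<tau> i) \<noteq> 0" using T(3) \<tau>T[OF i] by blast
    then show ?thesis using \<omega>[OF \<tau>T[OF i]] False
      by (simp add: \<rho>_def X_def Y_def Z_def algebra_simps power2_eq_square)
  qed
  moreover have "L (\<lambda>x y z. r x y z * s x y z) =
       (\<Sum>i<(6::nat). \<rho> i * (r (X i) (Y i) (Z i) * s (X i) (Y i) (Z i)))"
    if "quadratic r" "quadratic s" for r s
  proof -
    obtain a b d e f g where r: "r = qform a b d e f g" using \<open>quadratic r\<close> unfolding quadratic_def by blast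
    obtain a' b' d' e' f' g' where s: "s = qform a' b' d' e' f' g'" using \<open>quadratic s\<close> unfolding quadratic_def by blast
    let ?r = "[:d, g, b + f, e, a:]" and ?s = "[:d', g', b' + f', e', a':]"
    have "degree (?r * ?s) \<le> degree ?r + degree ?s" by (rule degree_mult_le)
    also have "\<dots> \<le> 4 + 4" by (intro add_mono) (auto intro: degree_pCons_le[THEN order_trans])
    finally have "\<Lambda> (?r * ?s) = (\<Sum>t\<in>T. \<omega> t * poly (?r * ?s) t)" by (intro quad) simp
    also have "\<dots> = (\<Sum>t\<in>T. \<omega> t * (r (t\<^sup>2) t 1 * s (t\<^sup>2) t 1))"
      by (rule sum.cong) (auto simp: r s qform_def algebra_simps power2_eq_square)
    also have "\<dots> = (\<Sum>i<5. \<omega> (\<tau> i) * (r ((\<tau> i)\<^sup>2) (\<tau> i) 1 * s ((\<tau> i)\<^sup>2) (\<tau> i) 1))"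
      by (rule sum.reindex_bij_betw[OF \<tau>, symmetric])
    also have "\<dots> = (\<Sum>i<5. \<rho> i * (r (X i) (Y i) (Z i) * s (X i) (Y i) (Z i)))"
      by (rule sum.cong) (auto simp: \<rho>_def X_def Y_def Z_def)
    finally have "\<Lambda> (?r * ?s) = \<dots>" .
    moreover have "{..<6::nat} = insert 5 {..<5}" by auto
    ultimately show ?thesis unfolding r s LL by (simp add: \<rho>_def X_def Y_def Z_def)
  qed
  ultimately show ?thesis unfolding six_atoms_off_def by blast
qed

text \<open>
  Completing the square gives \<open>4 a q = X\<^sup>2 + R(y, z)\<close>. As \<open>q\<close> cannot be a sum of squares, \<open>R\<close> takes the value \<open>-1\<close>
  somewhere, say at \<open>(s, t)\<close>. With \<open>B\<close> the polar form of \<open>-R\<close> at \<open>(s, t)\<close> and \<open>Z = t y - s z\<close>, the Gram determinant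
  identity reads \<open>-R = B\<^sup>2 + \<delta> Z\<^sup>2\<close>, so \<open>4 a q = (X - B) (X + B) - \<delta> Z\<^sup>2\<close> is a multiple of
  \<open>x z - y\<^sup>2\<close> in new coordinates.
\<close>

lemma six_atoms_if_nondegenerate_kernel:
  assumes K: "kernel_at 1 0 0 q" and nd: "nondegenerate q"
  shows "six_atoms_off 1 0 0"
proof -
  obtain a b c d e f where qe: "q = qform a b c d e f" and disc: "disc a b c d e f \<noteq> 0"
    using nd unfolding nondegenerate_def by blast
  note K = K[unfolded qe]
  have a: "a > 0" using kernel_at_diag_pos[OF K] by (simp add: qform_def)
  define \<alpha> \<beta> \<gamma> where "\<alpha> = 4 * a * b - d\<^sup>2" and "\<beta> = 2 * a * f - d * e" and "\<gamma> = 4 * a * c - e\<^sup>2"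
  define \<delta> where "\<delta> = \<alpha> * \<gamma> - \<beta>\<^sup>2"
  define \<kappa> where "\<kappa> = disc a b c d e f"
  have \<delta>: "\<delta> = 4 * a * \<kappa>"
    unfolding \<delta>_def \<alpha>_def \<beta>_def \<gamma>_def \<kappa>_def disc_def by Groebner_Basis.algebra
  then have \<delta>0: "\<delta> \<noteq> 0" using a disc by (simp add: \<kappa>_def)
  have "\<exists>y z. \<alpha> * y\<^sup>2 + 2 * \<beta> * (y * z) + \<gamma> * z\<^sup>2 < 0"
  proof (rule ccontr)
    assume "\<not> ?thesis"
    then have nn: "\<alpha> * y\<^sup>2 + 2 * \<beta> * (y * z) + \<gamma> * z\<^sup>2 \<ge> 0" for y z by (meson not_le)
    have "\<alpha> \<ge> 0" using nn[of 1 0] by simp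
    moreover have "\<alpha> \<noteq> 0"
    proof
      assume "\<alpha> = 0"
      then have "\<beta> \<noteq> 0" using \<delta>0 by (auto simp: \<delta>_def)
      then show False using nn[of "- (\<gamma> + 1) / (2 * \<beta>)" 1] \<open>\<alpha> = 0\<close> by simp
    qed
    ultimately have \<alpha>: "\<alpha> > 0" by simp
    have "\<alpha> * \<delta> = \<alpha> * (-\<beta>)\<^sup>2 + 2 * \<beta> * (-\<beta> * \<alpha>) + \<gamma> * \<alpha>\<^sup>2"
      by (simp add: \<delta>_def algebra_simps power2_eq_square)
    then have "\<alpha> * \<delta> \<ge> 0" using nn[of "-\<beta>" \<alpha>] by simp
    then have "\<delta> \<ge> 0" using \<alpha> by (simp add: zero_le_mult_iff)
    have "L (\<lambda>x y z. qform 0 d 0 (2 * a) 0 e x y z * qform 0 d 0 (2 * a) 0 e x y z) > 0"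
      using a by (intro pos) (auto simp: qform_eq_0_iff)
    moreover have "L (\<lambda>x y z. qform 0 \<alpha> 0 0 0 \<beta> x y z * qform 0 \<alpha> 0 0 0 \<beta> x y z) > 0"
      using \<alpha> by (intro pos) (auto simp: qform_eq_0_iff)
    moreover have "L (\<lambda>x y z. qform 0 0 0 0 0 1 x y z * qform 0 0 0 0 0 1 x y z) > 0"
      by (intro pos) (auto simp: qform_eq_0_iff)
    moreover have "4 * a * \<alpha> * L (\<lambda>x y z. qform a b c d e f x y z * qform 0 1 0 0 0 0 x y z) =
      \<alpha> * L (\<lambda>x y z. qform 0 d 0 (2 * a) 0 e x y z * qform 0 d 0 (2 * a) 0 e x y z)
      + L (\<lambda>x y z. qform 0 \<alpha> 0 0 0 \<beta> x y z * qform 0 \<alpha> 0 0 0 \<beta> x y z)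
      + \<delta> * L (\<lambda>x y z. qform 0 0 0 0 0 1 x y z * qform 0 0 0 0 0 1 x y z)"
      unfolding mult_qform_mom \<delta>_def \<alpha>_def \<beta>_def \<gamma>_def by (simp add: algebra_simps power2_eq_square)
    moreover have "L (\<lambda>x y z. qform a b c d e f x y z * qform 0 1 0 0 0 0 x y z) = 0"
      using kernel_atD[OF K quadratic_qform[of 0 1 0 0 0 0]] by (simp add: qform_def)
    moreover have "\<alpha> * L (\<lambda>x y z. qform 0 d 0 (2 * a) 0 e x y z * qform 0 d 0 (2 * a) 0 e x y z) > 0"
      using \<alpha> calculation(1) by simp
    moreover have "\<delta> * L (\<lambda>x y z. qform 0 0 0 0 0 1 x y z * qform 0 0 0 0 0 1 x y z) \<ge> 0"
      using \<open>\<delta> \<ge> 0\<close> calculation(3) by simp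
    ultimately show False by simp
  qed
  then obtain y z where neg: "\<alpha> * y\<^sup>2 + 2 * \<beta> * (y * z) + \<gamma> * z\<^sup>2 < 0" by blast
  define n where "n = sqrt (- (\<alpha> * y\<^sup>2 + 2 * \<beta> * (y * z) + \<gamma> * z\<^sup>2))"
  have n: "n > 0" "n\<^sup>2 = - (\<alpha> * y\<^sup>2 + 2 * \<beta> * (y * z) + \<gamma> * z\<^sup>2)" using neg by (auto simp: n_def)
  define s t where "s = y / n" and "t = z / n"
  have st: "\<alpha> * s\<^sup>2 + 2 * \<beta> * (s * t) + \<gamma> * t\<^sup>2 = -1"
  proof -
    have "n\<^sup>2 * (\<alpha> * s\<^sup>2 + 2 * \<beta> * (s * t) + \<gamma> * t\<^sup>2) = \<alpha> * (n * s)\<^sup>2 + 2 * \<beta> * ((n * s) * (n * t)) + \<gamma> * (n * t)\<^sup>2"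
      by Groebner_Basis.algebra
    also have "\<dots> = n\<^sup>2 * (-1)" using n by (simp add: s_def t_def)
    finally show ?thesis using n(1) by (simp only: mult_cancel_left) simp
  qed
  define B C where "B = - (\<alpha> * s + \<beta> * t)" and "C = - (\<beta> * s + \<gamma> * t)"
  have E: "B\<^sup>2 + \<delta> * t\<^sup>2 = - \<alpha>" "C\<^sup>2 + \<delta> * s\<^sup>2 = - \<gamma>" "B * C - \<delta> * (s * t) = - \<beta>" "s * B + t * C = 1"
  proof -
    let ?R = "\<alpha> * s\<^sup>2 + 2 * \<beta> * (s * t) + \<gamma> * t\<^sup>2"
    have "B\<^sup>2 + \<delta> * t\<^sup>2 = \<alpha> * ?R" "C\<^sup>2 + \<delta> * s\<^sup>2 = \<gamma> * ?R" "B * C - \<delta> * (s * t) = \<beta> * ?R"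
      "s * B + t * C = - ?R"
      by (simp_all add: B_def C_def \<delta>_def algebra_simps power2_eq_square)
    then show "B\<^sup>2 + \<delta> * t\<^sup>2 = - \<alpha>" "C\<^sup>2 + \<delta> * s\<^sup>2 = - \<gamma>" "B * C - \<delta> * (s * t) = - \<beta>"
      "s * B + t * C = 1"
      by (simp_all add: st)
  qed
  define p where "p = 1 / \<delta>"
  have p: "4 * a * (\<kappa> * p) = 1" "\<delta> * p = 1" using \<delta>0 \<delta> by (auto simp: p_def)
  let ?S = "lsub (2 * a * p) ((d - B) * p) ((e - C) * p) 0 t (-s) (2 * a) (d + B) (e + C)"
  have "det3 (2 * a * p) ((d - B) * p) ((e - C) * p) 0 t (-s) (2 * a) (d + B) (e + C) =
      4 * a * p * (s * B + t * C)"
    by (simp add: det3_def algebra_simps)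
  then have det: "det3 (2 * a * p) ((d - B) * p) ((e - C) * p) 0 t (-s) (2 * a) (d + B) (e + C) \<noteq> 0"
    using a p(2) E(4) by auto
  have eq: "?S (qform 0 (-\<kappa>) 0 0 \<kappa> 0) = qform a b c d e f"
  proof -
    have *: "x = y" if "4 * a * x = 4 * a * y" for x y using that a by simp
    have "\<kappa> * (2 * a * p * (2 * a)) = a" by (rule *) (use p(1) in Groebner_Basis.algebra)
    moreover have "- \<kappa> * t\<^sup>2 + \<kappa> * ((d - B) * p * (d + B)) = b"
    proof (rule *)
      have "4 * a * (- \<kappa> * t\<^sup>2 + \<kappa> * ((d - B) * p * (d + B))) =
        - (4 * a * \<kappa>) * t\<^sup>2 + 4 * a * (\<kappa> * p) * (d\<^sup>2 - B\<^sup>2)" by Groebner_Basis.algebra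
      also have "\<dots> = - \<delta> * t\<^sup>2 + d\<^sup>2 - B\<^sup>2" unfolding p(1) \<delta> by simp
      also have "\<dots> = 4 * a * b" using E(1) unfolding \<alpha>_def by Groebner_Basis.algebra
      finally show "4 * a * (- \<kappa> * t\<^sup>2 + \<kappa> * ((d - B) * p * (d + B))) = 4 * a * b" .
    qed
    moreover have "- \<kappa> * s\<^sup>2 + \<kappa> * ((e - C) * p * (e + C)) = c"
    proof (rule *)
      have "4 * a * (- \<kappa> * s\<^sup>2 + \<kappa> * ((e - C) * p * (e + C))) =
        - (4 * a * \<kappa>) * s\<^sup>2 + 4 * a * (\<kappa> * p) * (e\<^sup>2 - C\<^sup>2)" by Groebner_Basis.algebra
      also have "\<dots> = - \<delta> * s\<^sup>2 + e\<^sup>2 - C\<^sup>2" unfolding p(1) \<delta> by simp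
      also have "\<dots> = 4 * a * c" using E(2) unfolding \<gamma>_def by Groebner_Basis.algebra
      finally show "4 * a * (- \<kappa> * s\<^sup>2 + \<kappa> * ((e - C) * p * (e + C))) = 4 * a * c" .
    qed
    moreover have "\<kappa> * (2 * a * p * (d + B) + (d - B) * p * (2 * a)) = d"
      by (rule *) (use p(1) in Groebner_Basis.algebra)
    moreover have "\<kappa> * (2 * a * p * (e + C) + (e - C) * p * (2 * a)) = e"
      by (rule *) (use p(1) in Groebner_Basis.algebra)
    moreover have "2 * (\<kappa> * (t * s)) + \<kappa> * ((d - B) * p * (e + C) + (e - C) * p * (d + B)) = f"
    proof (rule *)
      have "4 * a * (2 * (\<kappa> * (t * s)) + \<kappa> * ((d - B) * p * (e + C) + (e - C) * p * (d + B))) =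
        2 * (4 * a * \<kappa>) * (s * t) + 4 * a * (\<kappa> * p) * (2 * (d * e) - 2 * (B * C))" by Groebner_Basis.algebra
      also have "\<dots> = 2 * \<delta> * (s * t) + 2 * (d * e) - 2 * (B * C)" unfolding p(1) \<delta> by simp
      also have "\<dots> = 4 * a * f" using E(3) unfolding \<beta>_def by Groebner_Basis.algebra
      finally show "4 * a * (2 * (\<kappa> * (t * s)) + \<kappa> * ((d - B) * p * (e + C) + (e - C) * p * (d + B))) = 4 * a * f" .
    qed
    ultimately show ?thesis
      unfolding lsub_qform qform_eq_iff by simp
  qed
  interpret M: quartic_functional "\<lambda>F. L (?S F)"
    by (rule quartic_functional_lsub[OF det])
  have MK: "M.kernel_at (2 * a * p) 0 (2 * a) (qform 0 (-\<kappa>) 0 0 \<kappa> 0)"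
    using K kernel_at_lsub[OF det, of 1 0 0 "qform 0 (-\<kappa>) 0 0 \<kappa> 0"] by (simp add: eq)
  \<comment> \<open>The first coordinate as a linear form in the new coordinates. Its value at the kernel point is 1.\<close>
  obtain h1 h2 h3 where h: "h1 * (2 * a * p) + h2 * 0 + h3 * (2 * a) = 1"
    "h1 * ((d - B) * p) + h2 * t + h3 * (d + B) = 0" "h1 * ((e - C) * p) + h2 * (-s) + h3 * (e + C) = 0"
  proof -
    obtain a' b' c' d' e' f' g' h' i' where inv: "\<And>F. ?S (lsub a' b' c' d' e' f' g' h' i' F) = F"
      by (rule lsub_inverse[OF det]) blast
    have inv': "?S (lsub a' b' c' d' e' f' g' h' i' F) u v w = F u v w" for F u v w by (simp only: inv)
    show thesis
      by (rule that[of a' b' c'])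
        (use inv'[of "\<lambda>x y z. x" 1 0 0] inv'[of "\<lambda>x y z. x" 0 1 0] inv'[of "\<lambda>x y z. x" 0 0 1]
         in \<open>simp_all add: lsub_def\<close>)
  qed
  have "M.six_atoms_off h1 h2 h3"
    using disc h(1) by (intro M.six_atoms_if_parametrized_conic[OF MK]) (auto simp: \<kappa>_def)
  from six_atoms_off_lsub[OF det this] show ?thesis by (simp only: h)
qed

lemma six_affine_atoms: "six_atoms_off 1 0 0"
proof -
  obtain v w q where q: "kernel_at 1 v w q" "nondegenerate q"
    using exists_affine_nondegenerate_kernel by blast
  have det: "det3 1 0 0 (-v) 1 0 (-w) 0 1 \<noteq> 0" "det3 1 0 0 v 1 0 w 0 1 \<noteq> 0" by (simp_all add: det3_def)
  let ?S = "lsub 1 0 0 (-v) 1 0 (-w) 0 1" and ?q = "lsub 1 0 0 v 1 0 w 0 1 q"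
  interpret M: quartic_functional "\<lambda>F. L (?S F)"
    by (rule quartic_functional_lsub[OF det(1)])
  have "?S ?q = q" by (simp add: lsub_def)
  then have "M.kernel_at 1 0 0 ?q"
    using q(1) kernel_at_lsub[OF det(1), of 1 v w ?q] by simp
  from M.six_atoms_if_nondegenerate_kernel[OF this nondegenerate_lsub[OF det(2) q(2)]]
  show ?thesis using six_atoms_off_lsub[OF det(1), of 1 0 0] by simp
qed

end

section \<open>The functional of a moment sequence\<close>

text \<open>
  The coefficient of \<open>t\<^sup>i\<close> in the polynomial of degree at most 4 that interpolates \<open>f\<close> at \<open>-2, -1, 0, 1, 2\<close>. Finite differences
  make it a linear functional on all functions.
\<close>

definition coeff_from_values :: "nat \<Rightarrow> (real \<Rightarrow> real) \<Rightarrow> real" where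
  "coeff_from_values i f =
    (if i = 0 then f 0
     else if i = 1 then (f (-2) - 8 * f (-1) + 8 * f 1 - f 2) / 12
     else if i = 2 then (- f (-2) + 16 * f (-1) - 30 * f 0 + 16 * f 1 - f 2) / 24
     else if i = 3 then (- f (-2) + 2 * f (-1) - 2 * f 1 + f 2) / 12
     else (f (-2) - 4 * f (-1) + 6 * f 0 - 4 * f 1 + f 2) / 24)"

lemma coeff_from_values_power:
  assumes "i \<le> 4" "j \<le> 4"
  shows "coeff_from_values i (\<lambda>t. t ^ j) = (if i = j then 1 else 0)"
proof -
  have i: "i = 0 \<or> i = 1 \<or> i = 2 \<or> i = 3 \<or> i = 4" using assms(1) by arith
  have j: "j = 0 \<or> j = 1 \<or> j = 2 \<or> j = 3 \<or> j = 4" using assms(2) by arith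
  show ?thesis using i by (elim disjE; use j in \<open>elim disjE; simp add: coeff_from_values_def\<close>)
qed

lemma coeff_from_values_add:
    "coeff_from_values i (\<lambda>t. f t + g t) = coeff_from_values i f + coeff_from_values i g"
  and coeff_from_values_scale:
    "coeff_from_values i (\<lambda>t. c * f t) = c * coeff_from_values i f"
  by (simp_all add: coeff_from_values_def add_divide_distrib diff_divide_distrib algebra_simps)

definition moment_functional :: "(nat \<Rightarrow> nat \<Rightarrow> real) \<Rightarrow> ternary \<Rightarrow> real" where
  "moment_functional \<beta> F =
    (\<Sum>i\<le>4. \<Sum>j\<le>4. \<beta> i j * coeff_from_values i (\<lambda>s. coeff_from_values j (\<lambda>t. F 1 s t)))"

interpretation mf: linear_functional "moment_functional \<beta>" for \<beta>
proof
  fix f g :: ternary and c :: real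
  show "moment_functional \<beta> (\<lambda>x y z. f x y z + g x y z) = moment_functional \<beta> f + moment_functional \<beta> g"
    unfolding moment_functional_def coeff_from_values_add distrib_left sum.distrib ..
  show "moment_functional \<beta> (\<lambda>x y z. c * f x y z) = c * moment_functional \<beta> f"
    unfolding moment_functional_def coeff_from_values_scale sum_distrib_left
    by (intro sum.cong refl) (rule mult.left_commute)
qed

lemma mom_moment_functional:
  assumes "i \<le> 4" "j \<le> 4"
  shows "mf.mom \<beta> k i j = \<beta> i j"
proof -
  have "coeff_from_values i' (\<lambda>s. coeff_from_values j' (\<lambda>t. 1 ^ k * s ^ i * t ^ j)) =
      (if j' = j then 1 else 0) * (if i' = i then 1 else 0)" if "i' \<le> 4" "j' \<le> 4" for i' j'
  proof -
    have "(\<lambda>s. coeff_from_values j' (\<lambda>t. 1 ^ k * s ^ i * t ^ j)) = (\<lambda>s. (if j' = j then 1 else 0) * s ^ i)"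
      by (rule ext) (simp only: coeff_from_values_scale coeff_from_values_power[OF that(2) assms(2)], simp)
    then show ?thesis
      by (simp only: coeff_from_values_scale coeff_from_values_power[OF that(1) assms(1)])
  qed
  then have "mf.mom \<beta> k i j =
      (\<Sum>i'\<le>4. \<Sum>j'\<le>4. \<beta> i' j' * ((if j' = j then 1 else 0) * (if i' = i then 1 else 0)))"
    unfolding mf.mom_def moment_functional_def by (intro sum.cong refl) simp
  also have "\<dots> = (\<Sum>i'\<le>4. if i' = i then (\<Sum>j'\<le>4. if j' = j then \<beta> i' j' else 0) else 0)"
    by (intro sum.cong refl) (auto intro!: sum.cong simp del: sum.delta sum.delta')
  also have "\<dots> = \<beta> i j" using assms by simp
  finally show ?thesis .
qed

lemma bi_indices_2: "bi_indices 2 = [(0,0), (1,0), (0,1), (2,0), (1,1), (0,2)]"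
  by (simp add: bi_indices_def upt_conv_Cons numeral_3_eq_3 numeral_2_eq_2)

lemma bi_indices_3:
  "bi_indices 3 = [(0,0), (1,0), (0,1), (2,0), (1,1), (0,2), (3,0), (2,1), (1,2), (0,3)]"
  by (simp add: bi_indices_def upt_conv_Cons numeral_3_eq_3 numeral_2_eq_2)

lemma moment_matrix_carrier:
  "moment_matrix n \<beta> \<in> carrier_mat (length (bi_indices n)) (length (bi_indices n))"
  by (simp add: moment_matrix_def Let_def)

lemma moment_matrix_index:
  "r < length (bi_indices n) \<Longrightarrow> c < length (bi_indices n) \<Longrightarrow> moment_matrix n \<beta> $$ (r, c) =
    \<beta> (fst (bi_indices n ! r) + fst (bi_indices n ! c)) (snd (bi_indices n ! r) + snd (bi_indices n ! c))"
  by (simp add: moment_matrix_def Let_def)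

lemma length_bi_indices_2: "length (bi_indices 2) = 6"
  and length_bi_indices_3: "length (bi_indices 3) = 10"
  by (simp_all add: bi_indices_2 bi_indices_3)

lemma moment_matrix_2_carrier: "moment_matrix 2 \<beta> \<in> carrier_mat 6 6"
  using moment_matrix_carrier[of 2 \<beta>] by (simp only: length_bi_indices_2)

lemma scalar_prod_mult_mat_vec:
  fixes A :: "real mat"
  assumes "A \<in> carrier_mat n n" "v \<in> carrier_vec n" "w \<in> carrier_vec n"
  shows "v \<bullet> (A *\<^sub>v w) = (\<Sum>r\<in>{0..<n}. \<Sum>c\<in>{0..<n}. v $ r * A $$ (r, c) * w $ c)"
  using assms by (simp add: scalar_prod_def sum_distrib_left mult.assoc)

text \<open>
  The order of the coefficients follows the indices \<open>1, s, t, s\<^sup>2, st, t\<^sup>2\<close>, which in homogeneous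
  coordinates are \<open>x\<^sup>2, xy, xz, y\<^sup>2, yz, z\<^sup>2\<close>.
\<close>

lemma moment_matrix_2_form:
  "Matrix.vec 6 (\<lambda>i. [a, d, e, b, f, c] ! i) \<bullet> (moment_matrix 2 \<beta> *\<^sub>v Matrix.vec 6 (\<lambda>i. [a', d', e', b', f', c'] ! i)) =
    moment_functional \<beta> (\<lambda>x y z. qform a b c d e f x y z * qform a' b' c' d' e' f' x y z)"
proof -
  have 6: "{0..<6::nat} = {0, 1, 2, 3, 4, 5}" by auto
  show ?thesis
    unfolding mf.mult_qform_mom
    by (subst scalar_prod_mult_mat_vec[OF moment_matrix_2_carrier])
      (simp_all add: mom_moment_functional 6 moment_matrix_index length_bi_indices_2
        bi_indices_2, simp_all add: numeral_eq_Suc algebra_simps)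
qed

lemma vec6_exhaust:
  assumes "v \<in> carrier_vec 6"
  obtains a b c d e f :: real where "v = Matrix.vec 6 (\<lambda>i. [a, d, e, b, f, c] ! i)"
proof
  show "v = Matrix.vec 6 (\<lambda>i. [v $ 0, v $ 1, v $ 2, v $ 3, v $ 4, v $ 5] ! i)"
    using assms by (intro eq_vecI) (auto simp: less_Suc_eq numeral_eq_Suc)
qed

lemma quadratic_nonneg_imp_linear_0:
  fixes B C :: real
  assumes "\<And>t. 2 * t * B + t\<^sup>2 * C \<ge> 0" "C \<ge> 0"
  shows "B = 0"
proof (rule ccontr)
  assume "B \<noteq> 0"
  \<comment> \<open>The minimum is at \<open>- B / C\<close>. Adding 1 to the denominator covers \<open>C = 0\<close>.\<close>
  define u where "u = B / (1 + C)"
  have u: "u \<noteq> 0" "B = u * (1 + C)" using \<open>B \<noteq> 0\<close> \<open>C \<ge> 0\<close> by (auto simp: u_def)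
  have "2 * (-u) * B + (-u)\<^sup>2 * C = - (u\<^sup>2 * (2 + C))"
    by (simp add: u(2) algebra_simps power2_eq_square)
  moreover have "u\<^sup>2 * (2 + C) > 0" using u(1) \<open>C \<ge> 0\<close> by simp
  ultimately show False using assms(1)[of "-u"] by simp
qed

text \<open>
  A positive semidefinite form vanishes at \<open>v\<close> only if \<open>v\<close> is in its radical, here the kernel of
  an invertible matrix.
\<close>

lemma quartic_functional_moment_functional:
  assumes psd: "positive_semidefinite_mat (moment_matrix 2 \<beta>)"
    and inv: "invertible_mat (moment_matrix 2 \<beta>)"
  shows "quartic_functional (moment_functional \<beta>)"
proof
  let ?M = "moment_matrix 2 \<beta>"
  have M: "?M \<in> carrier_mat 6 6" by (rule moment_matrix_2_carrier)
  define Q where "Q a b c d e f a' b' c' d' e' f' =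
    moment_functional \<beta> (\<lambda>x y z. qform a b c d e f x y z * qform a' b' c' d' e' f' x y z)"
    for a b c d e f a' b' c' d' e' f'
  have nonneg: "Q a b c d e f a b c d e f \<ge> 0" for a b c d e f
  proof -
    have "Matrix.vec 6 (\<lambda>i. [a, d, e, b, f, c] ! i) \<in> carrier_vec (dim_row ?M)"
      using M by simp
    then show ?thesis
      using psd unfolding positive_semidefinite_mat_def Q_def moment_matrix_2_form[symmetric] by blast
  qed
  fix q assume q: "quadratic q" "q \<noteq> (\<lambda>x y z. 0)"
  obtain a b c d e f where qe: "q = qform a b c d e f" using q(1) unfolding quadratic_def by blast
  show "moment_functional \<beta> (\<lambda>x y z. q x y z * q x y z) > 0"
  proof (rule ccontr)
    assume "\<not> ?thesis"
    then have 0: "Q a b c d e f a b c d e f = 0"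
      using nonneg[of a b c d e f] by (simp add: Q_def qe)
    \<comment> \<open>The nonnegative function \<open>t \<mapsto> Q (v + t w)\<close> is 0 at \<open>t = 0\<close>, so its linear coefficient vanishes.\<close>
    have B0: "Q a' b' c' d' e' f' a b c d e f = 0" for a' b' c' d' e' f'
    proof (rule quadratic_nonneg_imp_linear_0)
      show "Q a' b' c' d' e' f' a' b' c' d' e' f' \<ge> 0" by (rule nonneg)
      fix t
      have "2 * t * Q a' b' c' d' e' f' a b c d e f + t\<^sup>2 * Q a' b' c' d' e' f' a' b' c' d' e' f' =
        Q (a + t * a') (b + t * b') (c + t * c') (d + t * d') (e + t * e') (f + t * f')
          (a + t * a') (b + t * b') (c + t * c') (d + t * d') (e + t * e') (f + t * f')
        - Q a b c d e f a b c d e f"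
        unfolding Q_def mf.mult_qform_mom by (simp add: algebra_simps power2_eq_square)
      then show "2 * t * Q a' b' c' d' e' f' a b c d e f + t\<^sup>2 * Q a' b' c' d' e' f' a' b' c' d' e' f' \<ge> 0"
        using nonneg 0 by simp
    qed
    let ?v = "Matrix.vec 6 (\<lambda>i. [a, d, e, b, f, c] ! i)"
    have v: "?v \<in> carrier_vec 6" by simp
    have "?M *\<^sub>v ?v = 0\<^sub>v 6"
    proof -
      have Mv: "?M *\<^sub>v ?v \<in> carrier_vec 6" using M v by simp
      then obtain a' b' c' d' e' f' where w: "?M *\<^sub>v ?v = Matrix.vec 6 (\<lambda>i. [a', d', e', b', f', c'] ! i)"
        by (rule vec6_exhaust)
      have "(?M *\<^sub>v ?v) \<bullet> (?M *\<^sub>v ?v) = 0"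
        using B0[of a' b' c' d' e' f'] unfolding Q_def moment_matrix_2_form[symmetric] w[symmetric] .
      then show ?thesis using Mv using conjugate_square_eq_0_vec[OF Mv] by simp
    qed
    moreover obtain N where N: "inverts_mat N ?M" "inverts_mat ?M N" using inv unfolding invertible_mat_def by blast
    ultimately have "?v = 0\<^sub>v 6"
    proof -
      have NM: "N * ?M = 1\<^sub>m (dim_row N)" using N(1) by (simp add: inverts_mat_def)
      have MN: "?M * N = 1\<^sub>m 6" using N(2) M by (simp add: inverts_mat_def)
      have "dim_col (N * ?M) = 6" using M by simp
      then have dr: "dim_row N = 6" using NM by simp
      have "dim_col N = 6" using MN by (metis index_mult_mat(3) index_one_mat(3))
      then have Nc: "N \<in> carrier_mat 6 6" using dr by auto
      have "?v = (N * ?M) *\<^sub>v ?v" using NM dr v by simp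
      also have "\<dots> = N *\<^sub>v (?M *\<^sub>v ?v)" by (rule assoc_mult_mat_vec[OF Nc M v])
      also have "\<dots> = 0\<^sub>v 6" unfolding \<open>?M *\<^sub>v ?v = 0\<^sub>v 6\<close> using Nc by (intro eq_vecI) auto
      finally show ?thesis .
    qed
    then have "?v $ i = 0" if "i < 6" for i using that by simp
    from this[of 0] this[of 1] this[of 2] this[of 3] this[of 4] this[of 5]
    have "a = 0 \<and> b = 0 \<and> c = 0 \<and> d = 0 \<and> e = 0 \<and> f = 0"
      by simp
    then show False using q(2) by (simp add: qe qform_eq_0_iff)
  qed
qed

section \<open>Measures and moment matrices of atomic moment sequences\<close>

lemma pick_lessThan:
  assumes "i < m"
  shows "pick {..<m} i = i"
proof -
  have "pick {..<m} i \<in> {..<m}" using assms by (intro pick_in_set) simp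
  moreover have "card {a \<in> {..<m}. a < pick {..<m} i} = i"
    using assms by (intro card_pick) simp
  moreover have "{a \<in> {..<m}. a < pick {..<m} i} = {..<pick {..<m} i}" using calculation(1) by auto
  ultimately show ?thesis by simp
qed

lemma rank_sum_of_products_le:
  fixes f g :: "nat \<Rightarrow> nat \<Rightarrow> real"
  shows "vec_space.rank n (Matrix.mat n n (\<lambda>(r, c). \<Sum>k<m. f k r * g k c)) \<le> m"
proof (induction m)
  case 0
  have "Matrix.mat n n (\<lambda>(r, c). \<Sum>k<0. f k r * g k c) = 0\<^sub>m n n"
    by (rule eq_matI) auto
  then show ?case by (simp only: vec_space.rank_0I)
next
  case (Suc m)
  let ?A = "Matrix.mat n n (\<lambda>(r, c). \<Sum>k<m. f k r * g k c)" and ?B = "Matrix.mat n n (\<lambda>(r, c). f m r * g m c)"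
  have "Matrix.mat n n (\<lambda>(r, c). \<Sum>k<Suc m. f k r * g k c) = ?A + ?B"
    by (rule eq_matI) auto
  moreover have "vec_space.rank n (?A + ?B) \<le> vec_space.rank n ?A + vec_space.rank n ?B"
    by (rule vec_space.rank_subadditive) auto
  moreover have "vec_space.rank n ?B \<le> 1"
    by (rule vec_space.rank_le_1_product_entries[where f = "f m" and g = "g m"]) auto
  ultimately show ?case using Suc.IH by simp
qed

definition atomic_moments :: "(nat \<Rightarrow> real) \<Rightarrow> (nat \<Rightarrow> real) \<Rightarrow> (nat \<Rightarrow> real) \<Rightarrow> nat \<Rightarrow> nat \<Rightarrow> real" where
  "atomic_moments x y \<rho> i j = (\<Sum>k = 1..6. \<rho> k * x k ^ i * y k ^ j)"

lemma sum_from_1_to_6: "(\<Sum>k = 1..6. f k) = (\<Sum>k<6::nat. f (Suc k) :: real)"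
  by (rule sum.reindex_bij_witness[of _ Suc "\<lambda>k. k - 1"]) auto

lemma moment_matrix_atomic:
  "moment_matrix n (atomic_moments x y \<rho>) =
    (let I = bi_indices n; m = \<lambda>k r. x (Suc k) ^ fst (I ! r) * y (Suc k) ^ snd (I ! r)
     in Matrix.mat (length I) (length I) (\<lambda>(r, c). \<Sum>k<6. (\<rho> (Suc k) * m k r) * m k c))"
  unfolding moment_matrix_def Let_def atomic_moments_def sum_from_1_to_6
  by (rule cong_mat) (auto simp: power_add mult_ac intro!: sum.cong)

lemma positive_semidefinite_atomic:
  assumes "\<And>k. k \<in> {1..6} \<Longrightarrow> \<rho> k \<ge> 0"
  shows "positive_semidefinite_mat (moment_matrix n (atomic_moments x y \<rho>))"
proof -
  let ?I = "bi_indices n" and ?A = "moment_matrix n (atomic_moments x y \<rho>)"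
  let ?N = "length ?I"
  let ?m = "\<lambda>k r. x (Suc k) ^ fst (?I ! r) * y (Suc k) ^ snd (?I ! r)"
  have A: "?A \<in> carrier_mat ?N ?N" by (rule moment_matrix_carrier)
  have "transpose_mat ?A = ?A"
    using A by (intro eq_matI) (auto simp: moment_matrix_index add.commute)
  moreover have "0 \<le> v \<bullet> (?A *\<^sub>v v)" if v: "v \<in> carrier_vec ?N" for v
  proof -
    have "v \<bullet> (?A *\<^sub>v v) = (\<Sum>r\<in>{0..<?N}. \<Sum>c\<in>{0..<?N}. \<Sum>k<6. \<rho> (Suc k) * (v $ r * ?m k r) * (v $ c * ?m k c))"
      unfolding scalar_prod_mult_mat_vec[OF A v v]
      by (intro sum.cong refl) (simp add: moment_matrix_atomic Let_def sum_distrib_left sum_distrib_right mult_ac)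
    also have "\<dots> = (\<Sum>r\<in>{0..<?N}. \<Sum>k<6. \<Sum>c\<in>{0..<?N}. \<rho> (Suc k) * (v $ r * ?m k r) * (v $ c * ?m k c))"
      by (rule sum.cong[OF refl]) (rule sum.swap)
    also have "\<dots> = (\<Sum>k<6. \<Sum>r\<in>{0..<?N}. \<Sum>c\<in>{0..<?N}. \<rho> (Suc k) * (v $ r * ?m k r) * (v $ c * ?m k c))"
      by (rule sum.swap)
    also have "\<dots> = (\<Sum>k<6. \<rho> (Suc k) * (\<Sum>r\<in>{0..<?N}. v $ r * ?m k r)\<^sup>2)"
      by (rule sum.cong[OF refl], subst power2_eq_square, subst sum_product) (simp add: sum_distrib_left mult.assoc)
    also have "\<dots> \<ge> 0" using assms by (intro sum_nonneg) auto
    finally show ?thesis .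
  qed
  ultimately show ?thesis using A unfolding positive_semidefinite_mat_def by auto
qed

lemma rank_moment_matrix_2:
  assumes "invertible_mat (moment_matrix 2 \<beta>)"
  shows "Determinant.det (moment_matrix 2 \<beta>) \<noteq> 0" "mat_rank (moment_matrix 2 \<beta>) = 6"
proof -
  let ?M = "moment_matrix 2 \<beta>"
  have M: "?M \<in> carrier_mat 6 6" by (rule moment_matrix_2_carrier)
  obtain N where N: "?M * N = 1\<^sub>m 6" "N * ?M = 1\<^sub>m (dim_row N)"
    using assms M unfolding invertible_mat_def inverts_mat_def by auto
  have "dim_col N = 6" using N(1) by (metis index_mult_mat(3) index_one_mat(3))
  moreover have "dim_row N = 6" using N(2) M by (metis index_mult_mat(3) index_one_mat(3) carrier_matD(2))
  ultimately have "N \<in> carrier_mat 6 6" by auto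
  then have "Determinant.det ?M * Determinant.det N = 1" using N(1) M det_mult[of ?M 6 N] by simp
  then show "Determinant.det ?M \<noteq> 0" by auto
  then show "mat_rank ?M = 6" using vec_space.det_rank_iff[OF M] M by simp
qed

text \<open>
  At most 6 because each atom contributes a matrix of rank one, at least 6 because \<open>M(2)\<close> is the leading
  submatrix.
\<close>

lemma rank_moment_matrix_3_atomic:
  assumes "\<And>i j. i + j \<le> 4 \<Longrightarrow> atomic_moments x y \<rho> i j = \<beta> i j"
    and inv: "invertible_mat (moment_matrix 2 \<beta>)"
  shows "mat_rank (moment_matrix 3 (atomic_moments x y \<rho>)) = 6"
proof (rule antisym)
  let ?A = "moment_matrix 3 (atomic_moments x y \<rho>)"
  have A: "?A \<in> carrier_mat 10 10" using moment_matrix_carrier[of 3] by (simp only: length_bi_indices_3)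
  show "mat_rank ?A \<le> 6"
    unfolding moment_matrix_atomic Let_def dim_row_mat by (rule rank_sum_of_products_le)
  have c6: "{i. i < 10 \<and> i \<in> {..<6::nat}} = {..<6}" by auto
  have c6': "{i. i < 10 \<and> i < (6::nat)} = {..<6}" by auto
  have "submatrix ?A {..<6} {..<6} = moment_matrix 2 \<beta>"
  proof (rule eq_matI)
    fix i j assume "i < dim_row (moment_matrix 2 \<beta>)" "j < dim_col (moment_matrix 2 \<beta>)"
    then have ij: "i < 6" "j < 6" using moment_matrix_2_carrier[of \<beta>] by auto
    have nth: "bi_indices 3 ! r = bi_indices 2 ! r \<and> fst (bi_indices 2 ! r) + snd (bi_indices 2 ! r) \<le> 2"
      if "r < 6" for r
    proof -
      have "r = 0 \<or> r = 1 \<or> r = 2 \<or> r = 3 \<or> r = 4 \<or> r = 5" using that by arith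
      then show ?thesis by (elim disjE) (simp_all add: bi_indices_2 bi_indices_3)
    qed
    have "submatrix ?A {..<6} {..<6} $$ (i, j) = ?A $$ (i, j)"
      using A ij by (subst submatrix_index) (auto simp: c6' pick_lessThan)
    also have "\<dots> = moment_matrix 2 \<beta> $$ (i, j)"
      using ij nth[OF ij(1)] nth[OF ij(2)]
      by (simp add: moment_matrix_index length_bi_indices_2 length_bi_indices_3 assms(1))
    finally show "submatrix ?A {..<6} {..<6} $$ (i, j) = moment_matrix 2 \<beta> $$ (i, j)" .
  qed (use A moment_matrix_2_carrier[of \<beta>] in \<open>auto simp: dim_submatrix c6'\<close>)
  then have "Determinant.det (submatrix ?A {..<6} {..<6}) \<noteq> 0"
    using rank_moment_matrix_2(1)[OF inv] by simp
  then have "card {j. j < 10 \<and> j \<in> {..<6::nat}} \<le> vec_space.rank 10 ?A"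
    by (rule vec_space.rank_gt_minor[OF A])
  then show "6 \<le> mat_rank ?A" using A by (simp add: c6')
qed

lemma atomic_representing_measure:
  assumes inj: "inj_on (\<lambda>k. (x k, y k)) {1..6::nat}" and pos: "\<And>k. k \<in> {1..6} \<Longrightarrow> \<rho> k > 0"
    and mom: "\<And>i j. i + j \<le> d \<Longrightarrow> \<beta> i j = (\<Sum>k = 1..6. \<rho> k * x k ^ i * y k ^ j)"
  shows "\<exists>\<mu>. representing_measure d \<beta> \<mu> \<and> has_exactly_atoms \<mu> 6"
proof -
  let ?p = "\<lambda>k. (x k, y k)"
  define P where "P = point_measure {1..6::nat} (\<lambda>k. ennreal (\<rho> k))"
  define \<mu> where "\<mu> = distr P borel ?p"
  have p: "?p \<in> measurable P borel" by (simp add: P_def measurable_point_measure_eq1)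
  have "representing_measure d \<beta> \<mu>"
    unfolding representing_measure_def
  proof (intro conjI allI impI)
    show "sets \<mu> = sets borel" by (simp add: \<mu>_def)
    fix i j assume ij: "i + j \<le> d"
    have m: "(\<lambda>(s, t). s ^ i * t ^ j :: real) \<in> borel_measurable borel"
      by (intro borel_measurable_continuous_onI) (auto simp: split_beta intro!: continuous_intros)
    show "integrable \<mu> (\<lambda>(s, t). s ^ i * t ^ j)"
      unfolding \<mu>_def by (subst integrable_distr_eq[OF p m]) (simp add: P_def integrable_point_measure_finite)
    have "integral\<^sup>L \<mu> (\<lambda>(s, t). s ^ i * t ^ j) = integral\<^sup>L P (\<lambda>k. x k ^ i * y k ^ j)"
      unfolding \<mu>_def by (subst integral_distr[OF p m]) simp
    also have "\<dots> = (\<Sum>k = 1..6. \<rho> k * (x k ^ i * y k ^ j))"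
      unfolding P_def using pos by (subst lebesgue_integral_point_measure_finite) (auto simp: less_imp_le)
    finally show "\<beta> i j = integral\<^sup>L \<mu> (\<lambda>(s, t). s ^ i * t ^ j)" using mom[OF ij] by (simp add: mult.assoc)
  qed
  moreover have "has_exactly_atoms \<mu> 6"
    unfolding has_exactly_atoms_def
  proof (intro exI conjI ballI)
    show "finite (?p ` {1..6})" by simp
    show "card (?p ` {1..6}) = 6" using inj by (simp add: card_image)
    fix q assume "q \<in> ?p ` {1..6}"
    then obtain k where k: "k \<in> {1..6}" "q = ?p k" by blast
    have "?p -` {q} \<inter> space P = {k}"
      using k inj by (auto simp: P_def space_point_measure inj_on_def)
    then have "emeasure \<mu> {q} = emeasure P {k}"
      unfolding \<mu>_def using p by (subst emeasure_distr) auto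
    also have "\<dots> = ennreal (\<rho> k)" unfolding P_def using k by (subst emeasure_point_measure_finite) auto
    finally show "0 < emeasure \<mu> {q}" using pos[OF k(1)] by simp
  next
    have "?p ` {1..6} \<in> sets borel" by (intro borel_closed finite_imp_closed) simp
    then have "emeasure \<mu> (space \<mu> - ?p ` {1..6}) = emeasure P (?p -` (UNIV - ?p ` {1..6}) \<inter> space P)"
      unfolding \<mu>_def using p by (subst emeasure_distr) auto
    also have "?p -` (UNIV - ?p ` {1..6}) \<inter> space P = {}" by (auto simp: P_def space_point_measure)
    finally show "emeasure \<mu> (space \<mu> - ?p ` {1..6}) = 0" by simp
  qed
  ultimately show ?thesis by blast
qed

section \<open>The nonsingular quartic moment problem\<close>

text \<open>
  A form vanishing at all six points has square norm 0. So evaluation at the points is injective on the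
  6-dimensional space of quadratic forms, hence bijective. In particular, no two of the points are proportional.
\<close>

lemma (in quartic_functional) atoms_separated:
  fixes X Y Z \<rho> :: "nat \<Rightarrow> real"
  assumes repr: "\<And>r s. quadratic r \<Longrightarrow> quadratic s \<Longrightarrow> L (\<lambda>x y z. r x y z * s x y z) =
       (\<Sum>i<(6::nat). \<rho> i * (r (X i) (Y i) (Z i) * s (X i) (Y i) (Z i)))"
    and k: "k < 6"
  shows "\<exists>r. quadratic r \<and> (\<forall>i<6. r (X i) (Y i) (Z i) = (if i = k then 1 else 0))"
proof -
  let ?q = "\<lambda>(a, b, c, d, e, f). qform a b c d e f"
  define \<Phi> where "\<Phi> p = (?q p (X 0) (Y 0) (Z 0), ?q p (X 1) (Y 1) (Z 1), ?q p (X 2) (Y 2) (Z 2),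
      ?q p (X 3) (Y 3) (Z 3), ?q p (X 4) (Y 4) (Z 4), ?q p (X 5) (Y 5) (Z 5))"
    for p :: "real \<times> real \<times> real \<times> real \<times> real \<times> real"
  have lin: "linear \<Phi>"
    by (rule linearI) (auto simp: \<Phi>_def qform_def split_beta algebra_simps)
  have all: "(\<forall>i<6. P i) \<longleftrightarrow> P 0 \<and> P 1 \<and> P 2 \<and> P 3 \<and> P 4 \<and> P 5" for P :: "nat \<Rightarrow> bool"
  proof -
    have "i < 6 \<longleftrightarrow> i = 0 \<or> i = 1 \<or> i = 2 \<or> i = 3 \<or> i = 4 \<or> i = 5" for i :: nat by arith
    then show ?thesis by auto
  qed
  have "inj \<Phi>"
  proof (subst linear_injective_0[OF lin], intro allI impI)
    fix p assume p: "\<Phi> p = 0"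
    obtain a b c d e f where [simp]: "p = (a, b, c, d, e, f)" by (metis surj_pair)
    let ?r = "qform a b c d e f"
    have "\<forall>i<6. ?r (X i) (Y i) (Z i) = 0"
      unfolding all using p by (simp add: \<Phi>_def zero_prod_def)
    then have "L (\<lambda>x y z. ?r x y z * ?r x y z) = 0" by (subst repr) auto
    then have "?r = (\<lambda>x y z. 0)" using pos[of ?r] by force
    then show "p = 0" by (simp add: qform_eq_0_iff zero_prod_def)
  qed
  then have "surj \<Phi>" using linear_injective_imp_surjective[OF lin] by simp
  then obtain p where "\<Phi> p = (if 0 = k then 1 else 0, if 1 = k then 1 else 0, if 2 = k then 1 else 0,
     if 3 = k then 1 else 0, if 4 = k then 1 else 0, if 5 = k then 1 else 0)" by (metis surjD)
  then have "\<forall>i<6. ?q p (X i) (Y i) (Z i) = (if i = k then 1 else 0)"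
    unfolding all \<Phi>_def prod.inject by blast
  moreover have "quadratic (?q p)" by (simp add: split_beta)
  ultimately show ?thesis by blast
qed

lemma exists_six_atoms:
  assumes "quartic_functional (moment_functional \<beta>)"
  shows "\<exists>x y \<rho>. inj_on (\<lambda>k. (x k, y k)) {1..6::nat} \<and> (\<forall>k\<in>{1..6}. \<rho> k > (0::real)) \<and>
    (\<forall>i j. i + j \<le> 4 \<longrightarrow> \<beta> i j = (\<Sum>k = 1..6. \<rho> k * x k ^ i * y k ^ j))"
proof -
  interpret Q: quartic_functional "moment_functional \<beta>" by fact
  obtain X Y Z \<rho> where pos: "\<And>i. i < 6 \<Longrightarrow> \<rho> i > 0 \<and> X i \<noteq> 0"
    and repr: "\<And>r s. quadratic r \<Longrightarrow> quadratic s \<Longrightarrow> moment_functional \<beta> (\<lambda>x y z. r x y z * s x y z) =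
       (\<Sum>i<(6::nat). \<rho> i * (r (X i) (Y i) (Z i) * s (X i) (Y i) (Z i)))"
    using Q.six_affine_atoms
    unfolding Q.six_atoms_off_def mult_1 mult_zero_left add_0_right by blast
  \<comment> \<open>Scaling the points to first coordinate 1 multiplies values of quartic forms by \<open>1 / X ^ 4\<close>.\<close>
  define x y \<omega> where "x k = Y (k - 1) / X (k - 1)" and "y k = Z (k - 1) / X (k - 1)"
    and "\<omega> k = \<rho> (k - 1) * X (k - 1) ^ 4" for k
  interpret A: linear_functional "\<lambda>F. \<Sum>i<6. \<rho> i * F (X i) (Y i) (Z i)"
    by unfold_locales (simp_all add: distrib_left sum.distrib sum_distrib_left mult.left_commute)
  have eq: "moment_functional \<beta> (\<lambda>x y z. qform a b c d e f x y z * qform a' b' c' d' e' f' x y z) =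
    (\<Sum>i<6. \<rho> i * (qform a b c d e f (X i) (Y i) (Z i) * qform a' b' c' d' e' f' (X i) (Y i) (Z i)))"
    for a b c d e f a' b' c' d' e' f' by (rule repr) simp_all
  \<comment> \<open>Each of the fifteen degree-4 monomials is a product of two quadratic ones.\<close>
  have m400: "mf.mom \<beta> 4 0 0 = A.mom 4 0 0"
    using eq[of 1 0 0 0 0 0 1 0 0 0 0 0] unfolding mf.mult_qform_mom A.mult_qform_mom by simp
  have m040: "mf.mom \<beta> 0 4 0 = A.mom 0 4 0"
    using eq[of 0 1 0 0 0 0 0 1 0 0 0 0] unfolding mf.mult_qform_mom A.mult_qform_mom by simp
  have m004: "mf.mom \<beta> 0 0 4 = A.mom 0 0 4"
    using eq[of 0 0 1 0 0 0 0 0 1 0 0 0] unfolding mf.mult_qform_mom A.mult_qform_mom by simp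
  have m310: "mf.mom \<beta> 3 1 0 = A.mom 3 1 0"
    using eq[of 1 0 0 0 0 0 0 0 0 1 0 0] unfolding mf.mult_qform_mom A.mult_qform_mom by simp
  have m301: "mf.mom \<beta> 3 0 1 = A.mom 3 0 1"
    using eq[of 1 0 0 0 0 0 0 0 0 0 1 0] unfolding mf.mult_qform_mom A.mult_qform_mom by simp
  have m130: "mf.mom \<beta> 1 3 0 = A.mom 1 3 0"
    using eq[of 0 1 0 0 0 0 0 0 0 1 0 0] unfolding mf.mult_qform_mom A.mult_qform_mom by simp
  have m031: "mf.mom \<beta> 0 3 1 = A.mom 0 3 1"
    using eq[of 0 1 0 0 0 0 0 0 0 0 0 1] unfolding mf.mult_qform_mom A.mult_qform_mom by simp
  have m103: "mf.mom \<beta> 1 0 3 = A.mom 1 0 3"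
    using eq[of 0 0 1 0 0 0 0 0 0 0 1 0] unfolding mf.mult_qform_mom A.mult_qform_mom by simp
  have m013: "mf.mom \<beta> 0 1 3 = A.mom 0 1 3"
    using eq[of 0 0 1 0 0 0 0 0 0 0 0 1] unfolding mf.mult_qform_mom A.mult_qform_mom by simp
  have m220: "mf.mom \<beta> 2 2 0 = A.mom 2 2 0"
    using eq[of 1 0 0 0 0 0 0 1 0 0 0 0] unfolding mf.mult_qform_mom A.mult_qform_mom by simp
  have m202: "mf.mom \<beta> 2 0 2 = A.mom 2 0 2"
    using eq[of 1 0 0 0 0 0 0 0 1 0 0 0] unfolding mf.mult_qform_mom A.mult_qform_mom by simp
  have m022: "mf.mom \<beta> 0 2 2 = A.mom 0 2 2"
    using eq[of 0 1 0 0 0 0 0 0 1 0 0 0] unfolding mf.mult_qform_mom A.mult_qform_mom by simp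
  have m211: "mf.mom \<beta> 2 1 1 = A.mom 2 1 1"
    using eq[of 1 0 0 0 0 0 0 0 0 0 0 1] unfolding mf.mult_qform_mom A.mult_qform_mom by simp
  have m121: "mf.mom \<beta> 1 2 1 = A.mom 1 2 1"
    using eq[of 0 1 0 0 0 0 0 0 0 0 1 0] unfolding mf.mult_qform_mom A.mult_qform_mom by simp
  have m112: "mf.mom \<beta> 1 1 2 = A.mom 1 1 2"
    using eq[of 0 0 1 0 0 0 0 0 0 1 0 0] unfolding mf.mult_qform_mom A.mult_qform_mom by simp
  note m = m400 m040 m004 m310 m301 m130 m031 m103 m013 m220 m202 m022 m211 m121 m112
  have mom: "mf.mom \<beta> (4 - i - j) i j = A.mom (4 - i - j) i j" if "i + j \<le> 4" for i j
  proof -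
    have i: "i = 0 \<or> i = 1 \<or> i = 2 \<or> i = 3 \<or> i = 4" using that by arith
    have j: "j = 0 \<or> j = 1 \<or> j = 2 \<or> j = 3 \<or> j = 4" using that by arith
    show ?thesis
      using i by (elim disjE; use j that in \<open>elim disjE; simp add: m[unfolded One_nat_def]\<close>)
  qed
  have "\<beta> i j = (\<Sum>k = 1..6. \<omega> k * x k ^ i * y k ^ j)" if ij: "i + j \<le> 4" for i j
  proof -
    have "\<beta> i j = (\<Sum>k<6. \<rho> k * (X k ^ (4 - i - j) * Y k ^ i * Z k ^ j))"
      using mom[OF ij] ij by (simp add: mom_moment_functional A.mom_def)
    also have "\<dots> = (\<Sum>k<6. \<omega> (Suc k) * x (Suc k) ^ i * y (Suc k) ^ j)"
    proof (rule sum.cong[OF refl])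
      fix k :: nat assume "k \<in> {..<6}"
      then have "X k \<noteq> 0" using pos by auto
      moreover have "X k ^ 4 = X k ^ (4 - i - j) * X k ^ i * X k ^ j"
      proof -
        have "4 - i - j + i + j = 4" using ij by simp
        then show ?thesis by (metis power_add)
      qed
      ultimately show "\<rho> k * (X k ^ (4 - i - j) * Y k ^ i * Z k ^ j) = \<omega> (Suc k) * x (Suc k) ^ i * y (Suc k) ^ j"
        by (simp add: \<omega>_def x_def y_def power_divide)
    qed
    finally show ?thesis by (simp only: sum_from_1_to_6)
  qed
  moreover have "\<omega> k > 0" if "k \<in> {1..6}" for k
  proof -
    have "k - 1 < 6" using that by auto
    then show ?thesis using pos[of "k - 1"] by (simp add: \<omega>_def)
  qed
  moreover have "inj_on (\<lambda>k. (x k, y k)) {1..6::nat}"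
  proof (rule inj_onI, rule ccontr)
    fix k l :: nat assume kl: "k \<in> {1..6}" "l \<in> {1..6}" "(x k, y k) = (x l, y l)" "k \<noteq> l"
    let ?k = "k - 1" and ?l = "l - 1"
    have kl': "?k < 6" "?l < 6" "?l \<noteq> ?k" using kl by auto
    obtain r where r: "quadratic r" "\<forall>i<6. r (X i) (Y i) (Z i) = (if i = ?k then 1 else 0)"
      using Q.atoms_separated[OF repr kl'(1)] by blast
    obtain a b c d e f where re: "r = qform a b c d e f" using r(1) unfolding quadratic_def by blast
    have hom: "r (X i) (Y i) (Z i) = (X i)\<^sup>2 * r 1 (x (Suc i)) (y (Suc i))" if "i < 6" for i
      using pos[OF that] by (simp add: re qform_def x_def y_def field_simps power2_eq_square)
    have "Suc ?k = k" "Suc ?l = l" using kl by auto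
    then have "r 1 (x k) (y k) = 0" using hom[OF kl'(2)] r(2) kl' kl(3) pos[OF kl'(2)] by auto
    then show False using hom[OF kl'(1)] r(2) kl'(1) \<open>Suc ?k = k\<close> by simp
  qed
  ultimately show ?thesis
    by (intro exI[of _ x] exI[of _ y] exI[of _ \<omega>]) blast
qed

theorem theorem2p1:
  fixes \<beta> :: "nat \<Rightarrow> nat \<Rightarrow> real"
  assumes "\<beta> 0 0 > 0"
    and "positive_semidefinite_mat (moment_matrix 2 \<beta>)"
    and "invertible_mat (moment_matrix 2 \<beta>)"
  shows "(\<exists>\<mu>. representing_measure 4 \<beta> \<mu> \<and> has_exactly_atoms \<mu> 6) \<and>
    (\<exists>(x :: nat \<Rightarrow> real) (y :: nat \<Rightarrow> real) (\<rho> :: nat \<Rightarrow> real).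
      inj_on (\<lambda>k. (x k, y k)) {1..6} \<and>
      (\<forall>k \<in> {1..6}. \<rho> k > 0) \<and>
      (\<forall>i j. i + j \<le> 4 \<longrightarrow> \<beta> i j = (\<Sum>k = 1..6. \<rho> k * x k ^ i * y k ^ j))) \<and>
    (\<exists>\<gamma> :: nat \<Rightarrow> nat \<Rightarrow> real.
      (\<forall>i j. i + j \<le> 4 \<longrightarrow> \<gamma> i j = \<beta> i j) \<and>
      positive_semidefinite_mat (moment_matrix 3 \<gamma>) \<and>
      mat_rank (moment_matrix 3 \<gamma>) = mat_rank (moment_matrix 2 \<beta>) \<and>
      mat_rank (moment_matrix 2 \<beta>) = 6)"
proof -
  have "quartic_functional (moment_functional \<beta>)"
    using assms(2,3) by (rule quartic_functional_moment_functional)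
  from exists_six_atoms[OF this] obtain x y \<rho> where inj: "inj_on (\<lambda>k. (x k, y k)) {1..6::nat}"
    and pos': "\<forall>k\<in>{1..6}. \<rho> k > (0::real)"
    and mom': "\<forall>i j. i + j \<le> 4 \<longrightarrow> \<beta> i j = (\<Sum>k = 1..6. \<rho> k * x k ^ i * y k ^ j)"
    by blast
  have pos: "\<rho> k > 0" if "k \<in> {1..6}" for k using pos' that by simp
  have mom: "\<beta> i j = (\<Sum>k = 1..6. \<rho> k * x k ^ i * y k ^ j)" if "i + j \<le> 4" for i j
    using mom' that by simp
  let ?\<gamma> = "atomic_moments x y \<rho>"
  have \<gamma>: "?\<gamma> i j = \<beta> i j" if "i + j \<le> 4" for i j
    using mom[OF that] by (simp add: atomic_moments_def)
  have "\<exists>\<mu>. representing_measure 4 \<beta> \<mu> \<and> has_exactly_atoms \<mu> 6"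
    by (rule atomic_representing_measure[OF inj pos mom])
  moreover have "positive_semidefinite_mat (moment_matrix 3 ?\<gamma>)"
    using pos by (intro positive_semidefinite_atomic less_imp_le)
  moreover have "mat_rank (moment_matrix 3 ?\<gamma>) = 6"
    using \<gamma> assms(3) by (rule rank_moment_matrix_3_atomic)
  moreover have "mat_rank (moment_matrix 2 \<beta>) = 6"
    using assms(3) by (rule rank_moment_matrix_2(2))
  ultimately show ?thesis
    using inj pos' mom' \<gamma>
    by (intro conjI exI[of _ x] exI[of _ y] exI[of _ \<rho>] exI[of _ ?\<gamma>]) simp_all
qed

end
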